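(* Let $p\in\mathbb N$ with $(p+1)\alpha>1$, let $\mathbf X$ be an $\alpha$-Hölder rough path over $\mathbb R^d$ on $[0,T]$, let $\mathbf Z=(Z,Z')\in\mathcal D^\alpha_{\mathbf X}([0,T];\mathbb R^m)$, let $F_a\in C_b^{p+1}(\mathbb R^e;\mathbb R^e)$ for $a\in\mathcal A=\{1,\dots,m\}$, and let $(Y,Y')\in\mathcal D^\alpha_{\mathbf X}([0,T];\mathbb R^e)$ be the solution of $dY_t=\sum_aF_a(Y_t)\,d\mathbf Z^a_t$ with initial value $Y_0$. For a partition $\pi_h=\{0=t_0<\cdots<t_N=T\}$ with mesh $h$, let $Y^h$ be the solution of $dY^h_t=\sum_aF_a(Y^h_t)\,dZ^{h,a}_t$, $Y^h_0=Y_0$, with $Z^h$ the piecewise linear interpolation of $Z$ along $\pi_h$. Assume: (1) (Wong-Zakai) there exist $C_{\mathrm{WZ}}>0$, $r_0>0$, $h_0>0$ such that $\sup_{0\le t\le T}|Y_t-Y^h_t|\le C_{\mathrm{WZ}}h^{r_0}$ for every partition with mesh $0<h\le h_0$; (2) the simplified controlled Runge-Kutta method with tableau $(A,b)$ has solvable stage systems at each step and tree order $p$, i.e. $\widehat a(\tau)=1/\gamma(\tau)$ for all $\tau\in\mathcal T_{\le p}$; (3) for every $R>0$ there is $L_{R,T}>0$, independent of the partition, such that $|\varphi^h_{s,t}(y)-\varphi^h_{s,t}(\widetilde y)|\le L_{R,T}|y-\widetilde y|$ for all $y,\widetilde y\in B_R$, $0\le s\le t\le T$; (4) with $y_0^{\mathrm{SCRK}}:=Y_0$,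 $y_{n+1}^{\mathrm{SCRK}}:=\Psi^{\mathrm{SCRK}}_{t_n,t_{n+1}}(y_n^{\mathrm{SCRK}})$, the number $R>0$ is such that $y_n^{\mathrm{SCRK}}$, $\varphi^h_{t_n,t_{n+1}}(y_n^{\mathrm{SCRK}})$ and $\Psi^{\mathrm{SCRK}}_{t_n,t_{n+1}}(y_n^{\mathrm{SCRK}})$ all belong to $B_R$ for every $n=0,\dots,N-1$ (for all partitions considered). Then there exists a constant $C_{p,R,T}>0$, independent of $h$, such that $$\max_{0\le n\le N}|Y_{t_n}-y_n^{\mathrm{SCRK}}|\le C_{p,R,T}\bigl(h^{r_0}+h^{(p+1)\alpha-1}\bigr).$$ Consequently, as $h\downarrow0$, $\max_{0\le n\le N}|Y_{t_n}-y_n^{\mathrm{SCRK}}|=O\bigl(h^{\min\{r_0,(p+1)\alpha-1\}}\bigr)$.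
   Context: Fix $\alpha\in(1/3,1/2]$, $T>0$, $d,m,e,q\in\mathbb N$. $B_R=\{y\in\mathbb R^e:|y|\le R\}$; $h=\max_n|t_{n+1}-t_n|$, $h_n=t_{n+1}-t_n$; $X_{s,t}=X_t-X_s$. $C_b^k$ denotes $k$ times continuously differentiable maps with all derivatives of orders $0,\dots,k$ bounded. Rough and controlled paths. An $\alpha$-Hölder rough path over $\mathbb R^d$ is a pair $\mathbf X=(X,\mathbb X)$ with $X\in C^\alpha([0,T];\mathbb R^d)$ and $\mathbb X:\{0\le s\le t\le T\}\to\mathbb R^{d\times d}$ with $\sup_{s<t}|\mathbb X_{s,t}|/|t-s|^{2\alpha}<\infty$ and $\mathbb X_{s,t}=\mathbb X_{s,u}+\mathbb X_{u,t}+X_{s,u}\otimes X_{u,t}$. $\mathcal D^\alpha_{\mathbf X}([0,T];V)$ is the set of pairs $(Y,Y')$ with $Y\in C^\alpha([0,T];V)$, $Y'\in C^\alpha([0,T];\mathcal L(\mathbb R^d,V))$ and $\sup_{s<t}|Y_{s,t}-Y'_sX_{s,t}|/|t-s|^{2\alpha}<\infty$. The controlled rough integral is $\int_s^tH_r\,d\mathbf Z_r:=\lim_{|P|\to0}\sum_{[u,v]\in P}(H_uZ_{u,v}+(H'_u\diamond Z'_u)\mathbb X_{u,v})$ with $(A\diamond B)(x\otimes\tilde x):=A(x)(B\tilde x)$. With $F(y)e_a=F_a(y)$, a solution is $(Y,Y')\in\mathcal D^\alpha_{\mathbf X}([0,T];\mathbb R^e)$ with $Y_t=Y_0+\int_0^tF(Y_r)\,d\mathbf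 Z_r$, $Y'_t=F(Y_t)Z'_t$, where $F(Y)$ has Gubinelli derivative $DF(Y_t)Y'_t$. Interpolation: $Z^h_t=Z_{t_n}+\frac{t-t_n}{h_n}(Z_{t_{n+1}}-Z_{t_n})$ for $t\in(t_n,t_{n+1}]$, $Z^h_0=Z_0$; the equation driven by $Z^h$ is, on each $(t_n,t_{n+1})$, the ODE $\frac{d}{dt}Y^h_t=\sum_aF_a(Y^h_t)\frac{Z^a_{t_{n+1}}-Z^a_{t_n}}{h_n}$. $\varphi^h_{s,t}(y)$ is the value at time $t$ of the solution of this equation started from $y$ at time $s$. Simplified controlled Runge-Kutta method ($A=(a_{ij})\in\mathbb R^{q\times q}$, $b\in\mathbb R^q$): with $\Delta Z^a_{u,v}=Z^a_v-Z^a_u$, the stages are $Y_i^{u,v}(y)=y+\sum_{a=1}^m\sum_{j=1}^qa_{ij}\Delta Z^a_{u,v}F_a(Y_j^{u,v}(y))$, $i=1,\dots,q$ (a solution, assumed to exist at each step when $A$ is not strictly lower triangular), and $\Psi^{\mathrm{SCRK}}_{u,v}(y)=y+\sum_{a=1}^m\sum_{i=1}^qb_i\Delta Z^a_{u,v}F_a(Y_i^{u,v}(y))$. Trees: $\mathcal T$ is the set of (nonplanar) rooted trees with vertices decorated by $\mathcal A$, $\mathbf 1$ the empty tree, $[\tau_1\cdots\tau_n]_a$ the tree obtained by joining the roots of $\tau_1,\dots,\tau_n$ to a new root decorated by $a$, $\bullet_a=[\mathbf 1]_a$, $|\tau|$ the number of vertices, $\mathcal T_{\le p}=\{\tau\in\mathcal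 T:|\tau|\le p\}$. Tree factorial: $\gamma(\mathbf 1)=\gamma(\bullet_a)=1$, $\gamma(\tau)=|\tau|\prod_{i=1}^k\gamma(\tau_i)$ for $\tau=[\tau_1\cdots\tau_k]_a$. With $\odot$ the componentwise product on $\mathbb R^q$ and $\mathbf 1_q=(1,\dots,1)^\top$ (the empty product): $\widehat\Phi(\mathbf 1)=\mathbf 1_q$, $\widehat\Phi([\tau_1\cdots\tau_n]_a)=A(\widehat\Phi(\tau_1)\odot\cdots\odot\widehat\Phi(\tau_n))$, $\widehat a(\mathbf 1)=1$, $\widehat a([\tau_1\cdots\tau_n]_a)=\langle b,\widehat\Phi(\tau_1)\odot\cdots\odot\widehat\Phi(\tau_n)\rangle_{\mathbb R^q}$. *)

theory Defs
  imports "HOL-Analysis.Analysis" "HOL-Library.Multiset" "HOL-Library.Landau_Symbols"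
begin

subsection \<open>Partitions\<close>

text \<open>A partition \<open>t\<^sub>0 < \<dots> < t\<^sub>N\<close> is the list of its \<open>N + 1\<close> points.\<close>

definition is_partition :: "real \<Rightarrow> real \<Rightarrow> real list \<Rightarrow> bool" where
  "is_partition s t P \<longleftrightarrow> P \<noteq> [] \<and> sorted_wrt (<) P \<and> hd P = s \<and> last P = t"

definition steps :: "real list \<Rightarrow> nat" where
  "steps P = length P - 1"

text \<open>The inserted \<open>0\<close> only matters for the one-point partition of a degenerate interval.\<close>

definition mesh :: "real list \<Rightarrow> real" where
  "mesh P = Max (insert 0 ((\<lambda>n. P ! Suc n - P ! n) ` {..<steps P}))"

text \<open>The filter of a family of partitions, directed by mesh tending to \<open>0\<close>.\<close>

definition mesh_to_0 :: "real list set \<Rightarrow> real list filter" where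
  "mesh_to_0 \<P> = inf (filtercomap mesh (nhds 0)) (principal \<P>)"


subsection \<open>Rough paths, controlled paths, rough integrals\<close>

definition hoelder_on :: "real \<Rightarrow> real \<Rightarrow> (real \<Rightarrow> 'v::real_normed_vector) \<Rightarrow> bool" where
  "hoelder_on \<alpha> T X \<longleftrightarrow>
     (\<exists>C. \<forall>s\<in>{0..T}. \<forall>t\<in>{0..T}. norm (X t - X s) \<le> C * \<bar>t - s\<bar> powr \<alpha>)"

definition outer :: "real^'d \<Rightarrow> real^'d \<Rightarrow> real^'d^'d" where
  "outer x y = (\<chi> i j. x $ i * y $ j)"

definition rough_path ::
  "real \<Rightarrow> real \<Rightarrow> (real \<Rightarrow> real^'d) \<Rightarrow> (real \<Rightarrow> real \<Rightarrow> real^'d^'d) \<Rightarrow> bool" where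
  "rough_path \<alpha> T X XX \<longleftrightarrow>
     hoelder_on \<alpha> T X \<and>
     (\<exists>C. \<forall>s t. 0 \<le> s \<and> s < t \<and> t \<le> T \<longrightarrow> norm (XX s t) \<le> C * (t - s) powr (2 * \<alpha>)) \<and>
     (\<forall>s u t. 0 \<le> s \<and> s \<le> u \<and> u \<le> t \<and> t \<le> T \<longrightarrow>
        XX s t = XX s u + XX u t + outer (X u - X s) (X t - X u))"

definition controlled ::
  "real \<Rightarrow> real \<Rightarrow> (real \<Rightarrow> real^'d) \<Rightarrow> (real \<Rightarrow> 'v::real_normed_vector)
     \<Rightarrow> (real \<Rightarrow> (real^'d) \<Rightarrow>\<^sub>L 'v) \<Rightarrow> bool" where
  "controlled \<alpha> T X Y Y' \<longleftrightarrow>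
     hoelder_on \<alpha> T Y \<and> hoelder_on \<alpha> T Y' \<and>
     (\<exists>C. \<forall>s t. 0 \<le> s \<and> s < t \<and> t \<le> T \<longrightarrow>
        norm (Y t - Y s - Y' s (X t - X s)) \<le> C * (t - s) powr (2 * \<alpha>))"

text \<open>The linear map on matrices determined by
  \<open>diamond A B (outer x y) = A x (B y)\<close>.\<close>

definition diamond ::
  "((real^'d) \<Rightarrow>\<^sub>L ('w::real_normed_vector \<Rightarrow>\<^sub>L 'v::real_normed_vector)) \<Rightarrow> ((real^'d) \<Rightarrow>\<^sub>L 'w)
     \<Rightarrow> real^'d^'d \<Rightarrow> 'v" where
  "diamond A B M =
     (\<Sum>i\<in>UNIV. \<Sum>j\<in>UNIV. (M $ i $ j) *\<^sub>R
        blinfun_apply (blinfun_apply A (axis i 1)) (blinfun_apply B (axis j 1)))"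

lemma diamond_outer: "diamond A B (outer x y) = blinfun_apply (blinfun_apply A x) (blinfun_apply B y)"
proof -
  have x: "x = (\<Sum>i\<in>UNIV. x $ i *\<^sub>R axis i 1)" for x :: "real^'d"
    by (metis basis_expansion scalar_mult_eq_scaleR)
  have "blinfun_apply (blinfun_apply A x) (blinfun_apply B y) =
      blinfun_apply (blinfun_apply A (\<Sum>i\<in>UNIV. x $ i *\<^sub>R axis i 1))
        (blinfun_apply B (\<Sum>j\<in>UNIV. y $ j *\<^sub>R axis j 1))"
    using x[of x] x[of y] by simp
  also have "\<dots> = diamond A B (outer x y)"
    by (simp add: diamond_def outer_def blinfun.sum_right blinfun.sum_left blinfun.scaleR_right
        blinfun.scaleR_left scaleR_sum_right mult.commute, rule sum.swap)
  finally show ?thesis by simp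
qed

text \<open>\<open>has_rough_integral XX s t H H' Z Z' I\<close> means \<open>I = \<integral>\<^sub>s\<^sup>t H d(Z, Z')\<close>, as the limit of
  compensated Riemann sums.\<close>

definition has_rough_integral ::
  "(real \<Rightarrow> real \<Rightarrow> real^'d^'d) \<Rightarrow> real \<Rightarrow> real
     \<Rightarrow> (real \<Rightarrow> 'w::real_normed_vector \<Rightarrow>\<^sub>L 'v::real_normed_vector)
     \<Rightarrow> (real \<Rightarrow> (real^'d) \<Rightarrow>\<^sub>L ('w \<Rightarrow>\<^sub>L 'v))
     \<Rightarrow> (real \<Rightarrow> 'w) \<Rightarrow> (real \<Rightarrow> (real^'d) \<Rightarrow>\<^sub>L 'w) \<Rightarrow> 'v \<Rightarrow> bool" where
  "has_rough_integral XX s t H H' Z Z' I \<longleftrightarrow>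
     ((\<lambda>P. \<Sum>n<steps P. H (P ! n) (Z (P ! Suc n) - Z (P ! n))
                      + diamond (H' (P ! n)) (Z' (P ! n)) (XX (P ! n) (P ! Suc n)))
        \<longlongrightarrow> I) (mesh_to_0 {P. is_partition s t P})"


subsection \<open>Vector fields and rough differential equations\<close>

text \<open>\<open>Cb k f\<close>: \<open>f\<close> is \<open>k\<close> times continuously differentiable and its derivatives of orders
  \<open>0, \<dots>, k\<close> are bounded. The higher derivatives are handled through the iterated directional
  derivatives \<open>x \<mapsto> D\<^sup>jf(x)(v\<^sub>1, \<dots>, v\<^sub>j)\<close>; as the domain is finite-dimensional, continuity and
  boundedness of these for all fixed directions is continuity and boundedness of \<open>D\<^sup>jf\<close>.\<close>

primrec Cb :: "nat \<Rightarrow> ('a::euclidean_space \<Rightarrow> 'b::real_normed_vector) \<Rightarrow> bool" where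
  "Cb 0 f \<longleftrightarrow> continuous_on UNIV f \<and> bounded (range f)"
| "Cb (Suc k) f \<longleftrightarrow> (\<forall>x. f differentiable (at x)) \<and> bounded (range f)
     \<and> (\<forall>v. Cb k (\<lambda>x. frechet_derivative f (at x) v))"

definition field_op :: "('m \<Rightarrow> real^'e \<Rightarrow> real^'e) \<Rightarrow> real^'e \<Rightarrow> (real^'m::finite) \<Rightarrow>\<^sub>L (real^'e)" where
  "field_op F y = Blinfun (\<lambda>z. \<Sum>a\<in>UNIV. z $ a *\<^sub>R F a y)"

lemma blinfun_apply_field_op: "blinfun_apply (field_op F y) z = (\<Sum>a\<in>UNIV. z $ a *\<^sub>R F a y)"
proof -
  have "bounded_linear (\<lambda>z. \<Sum>a\<in>UNIV. z $ a *\<^sub>R F a y)"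
    by (intro bounded_linear_sum bounded_linear_scaleR_const bounded_linear_vec_nth)
  then show ?thesis
    by (simp add: field_op_def bounded_linear_Blinfun_apply)
qed

lemma field_op_axis: "blinfun_apply (field_op F y) (axis a 1) = F a y"
proof -
  have "(\<Sum>b\<in>UNIV. axis a 1 $ b *\<^sub>R F b y) = (\<Sum>b\<in>UNIV. if b = a then F b y else 0)"
    by (intro sum.cong) (auto simp: axis_def)
  then show ?thesis by (simp add: blinfun_apply_field_op)
qed

definition rde_solution ::
  "real \<Rightarrow> real \<Rightarrow> (real \<Rightarrow> real^'d) \<Rightarrow> (real \<Rightarrow> real \<Rightarrow> real^'d^'d)
     \<Rightarrow> (real \<Rightarrow> real^'m) \<Rightarrow> (real \<Rightarrow> (real^'d) \<Rightarrow>\<^sub>L (real^'m))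
     \<Rightarrow> ('m \<Rightarrow> real^'e \<Rightarrow> real^'e)
     \<Rightarrow> (real \<Rightarrow> real^'e) \<Rightarrow> (real \<Rightarrow> (real^'d) \<Rightarrow>\<^sub>L (real^'e)) \<Rightarrow> bool" where
  "rde_solution \<alpha> T X XX Z Z' F Y Y' \<longleftrightarrow>
     controlled \<alpha> T X Y Y' \<and>
     (\<forall>t\<in>{0..T}. has_rough_integral XX 0 t
        (\<lambda>r. field_op F (Y r))
        (\<lambda>r. Blinfun (frechet_derivative (field_op F) (at (Y r))) o\<^sub>L Y' r)
        Z Z' (Y t - Y 0)) \<and>
     (\<forall>t\<in>{0..T}. Y' t = field_op F (Y t) o\<^sub>L Z' t)"


subsection \<open>The equation driven by the piecewise linear interpolation\<close>

definition interpolation :: "(real \<Rightarrow> 'v::real_vector) \<Rightarrow> real list \<Rightarrow> real \<Rightarrow> 'v" where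
  "interpolation Z P t =
     (if t \<le> hd P then Z (hd P)
      else let n = (THE n. n < steps P \<and> P ! n < t \<and> t \<le> P ! Suc n)
           in Z (P ! n) + ((t - P ! n) / (P ! Suc n - P ! n)) *\<^sub>R (Z (P ! Suc n) - Z (P ! n)))"

text \<open>\<open>U\<close> solves \<open>dU = \<Sum>\<^sub>a F\<^sub>a(U) dZ\<^sup>h\<^sup>,\<^sup>a\<close> from time \<open>s\<close> up to the end of the partition \<open>P\<close>, where
  \<open>Z\<^sup>h = interpolation Z P\<close>; see \<open>interpolation_has_vector_derivative\<close> below for the slope.\<close>

definition interpolated_solution ::
  "('m \<Rightarrow> real^'e \<Rightarrow> real^'e) \<Rightarrow> (real \<Rightarrow> real^'m) \<Rightarrow> real list \<Rightarrow> real \<Rightarrow> (real \<Rightarrow> real^'e) \<Rightarrow> bool" where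
  "interpolated_solution F Z P s U \<longleftrightarrow>
     continuous_on {s..last P} U \<and>
     (\<forall>n<steps P. \<forall>t\<in>{P ! n<..<P ! Suc n}. s < t \<longrightarrow>
        (U has_vector_derivative
           (\<Sum>a\<in>UNIV. ((Z (P ! Suc n) $ a - Z (P ! n) $ a) / (P ! Suc n - P ! n)) *\<^sub>R F a (U t)))
          (at t))"

lemma interpolation_has_vector_derivative:
  assumes P: "sorted_wrt (<) P" and n: "n < steps P" and t: "t \<in> {P ! n<..<P ! Suc n}"
  shows "(interpolation Z P has_vector_derivative
           ((1 / (P ! Suc n - P ! n)) *\<^sub>R (Z (P ! Suc n) - Z (P ! n)))) (at t)"
proof -
  let ?f = "\<lambda>t. Z (P ! n) + ((t - P ! n) / (P ! Suc n - P ! n)) *\<^sub>R (Z (P ! Suc n) - Z (P ! n))"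
  have mono: "P ! i \<le> P ! j" if "i \<le> j" "j \<le> steps P" for i j
  proof (cases "i = j")
    case False
    with that n have "i < j" "j < length P" by (auto simp: steps_def)
    then show ?thesis
      using sorted_wrt_nth_less[OF P, of i j] by simp
  qed simp
  have eq: "interpolation Z P u = ?f u" if u: "u \<in> {P ! n<..<P ! Suc n}" for u
  proof -
    have "P \<noteq> []" using n by (auto simp: steps_def)
    then have "hd P \<le> P ! n" using mono[of 0 n] n by (simp add: hd_conv_nth)
    moreover have "(THE k. k < steps P \<and> P ! k < u \<and> u \<le> P ! Suc k) = n"
    proof (rule the_equality)
      fix k assume k: "k < steps P \<and> P ! k < u \<and> u \<le> P ! Suc k"
      show "k = n"
      proof (rule linorder_cases[of k n])
        assume "k < n" then show ?thesis using mono[of "Suc k" n] k u n by auto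
      next
        assume "n < k" then show ?thesis using mono[of "Suc n" k] k u n by auto
      qed
    qed (use n u in auto)
    ultimately show ?thesis using u by (simp add: interpolation_def)
  qed
  have "(?f has_vector_derivative
      ((1 / (P ! Suc n - P ! n)) *\<^sub>R (Z (P ! Suc n) - Z (P ! n)))) (at t)"
    using t by (auto intro!: derivative_eq_intros simp: divide_simps)
  then show ?thesis
    by (rule has_vector_derivative_transform_within_open[where S = "{P ! n<..<P ! Suc n}"])
       (use t eq in auto)
qed

text \<open>\<open>flow F Z P s t y\<close> is \<open>\<phi>\<^sup>h\<^sub>s\<^sub>,\<^sub>t(y)\<close>.\<close>

definition flow ::
  "('m \<Rightarrow> real^'e \<Rightarrow> real^'e) \<Rightarrow> (real \<Rightarrow> real^'m) \<Rightarrow> real list \<Rightarrow> real \<Rightarrow> real \<Rightarrow> real^'e \<Rightarrow> real^'e" where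
  "flow F Z P s t y = (THE z. \<exists>U. interpolated_solution F Z P s U \<and> U s = y \<and> U t = z)"


subsection \<open>Simplified controlled Runge-Kutta methods\<close>

definition scrk_stages ::
  "real^'q^'q \<Rightarrow> ('m::finite \<Rightarrow> real^'e \<Rightarrow> real^'e) \<Rightarrow> (real \<Rightarrow> real^'m) \<Rightarrow> real \<Rightarrow> real
     \<Rightarrow> real^'e \<Rightarrow> ('q \<Rightarrow> real^'e) \<Rightarrow> bool" where
  "scrk_stages A F Z u v y S \<longleftrightarrow>
     (\<forall>i. S i = y + (\<Sum>a\<in>UNIV. \<Sum>j\<in>UNIV. (A $ i $ j * (Z v $ a - Z u $ a)) *\<^sub>R F a (S j)))"

text \<open>The stage system of an implicit method need not have a unique solution, so the stages are a
  parameter: \<open>S u v y i\<close> is \<open>Y\<^sub>i\<^sup>u\<^sup>,\<^sup>v(y)\<close>, to be constrained by \<open>scrk_stages\<close>.\<close>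

definition scrk_step ::
  "real^'q \<Rightarrow> ('m::finite \<Rightarrow> real^'e \<Rightarrow> real^'e) \<Rightarrow> (real \<Rightarrow> real^'m)
     \<Rightarrow> (real \<Rightarrow> real \<Rightarrow> real^'e \<Rightarrow> 'q \<Rightarrow> real^'e) \<Rightarrow> real \<Rightarrow> real \<Rightarrow> real^'e \<Rightarrow> real^'e" where
  "scrk_step b F Z S u v y =
     y + (\<Sum>a\<in>UNIV. \<Sum>i\<in>UNIV. (b $ i * (Z v $ a - Z u $ a)) *\<^sub>R F a (S u v y i))"


subsection \<open>Decorated rooted trees and order conditions\<close>

text \<open>Nonempty nonplanar trees; the set of all trees, including the empty one, is
  \<open>'a rtree option\<close> with \<open>None\<close> as the empty tree. The single vertex is \<open>Node a {#}\<close>.\<close>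

datatype 'a rtree = Node 'a "'a rtree multiset"

primrec vertices :: "'a rtree \<Rightarrow> nat" where
  "vertices (Node a ts) = Suc (\<Sum>\<^sub># (image_mset vertices ts))"

primrec fact_rtree :: "'a rtree \<Rightarrow> nat" where
  "fact_rtree (Node a ts) = vertices (Node a ts) * prod_mset (image_mset fact_rtree ts)"

text \<open>Multiplication and \<open>1\<close> on \<open>real^'q\<close> are componentwise.\<close>

primrec stage_weight :: "real^'q^'q \<Rightarrow> 'a rtree \<Rightarrow> real^'q" where
  "stage_weight A (Node a ts) = A *v prod_mset (image_mset (stage_weight A) ts)"

fun step_weight :: "real^'q^'q \<Rightarrow> real^'q \<Rightarrow> 'a rtree \<Rightarrow> real" where
  "step_weight A b (Node a ts) = b \<bullet> prod_mset (image_mset (stage_weight A) ts)"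

definition tree_size :: "'a rtree option \<Rightarrow> nat" where
  "tree_size \<tau> = (case \<tau> of None \<Rightarrow> 0 | Some t \<Rightarrow> vertices t)"

definition tree_fact :: "'a rtree option \<Rightarrow> nat" where
  "tree_fact \<tau> = (case \<tau> of None \<Rightarrow> 1 | Some t \<Rightarrow> fact_rtree t)"

definition tree_weight :: "real^'q^'q \<Rightarrow> real^'q \<Rightarrow> 'a rtree option \<Rightarrow> real" where
  "tree_weight A b \<tau> = (case \<tau> of None \<Rightarrow> 1 | Some t \<Rightarrow> step_weight A b t)"

end

theory Submission
  imports Defs
begin

text \<open>The error splits at the solution \<open>Y\<^sup>h\<close> of the interpolated equation. The distance from \<open>Y\<close> to \<open>Y\<^sup>h\<close> is
the Wong-Zakai error \<open>h\<^sup>r\<^sup>0\<close>; what remains is the global error of a Runge-Kutta method for an ordinary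
differential equation.

On one step of the partition the interpolated driver is a straight line. Rescaled to unit time the
equation reads \<open>U' = \<Sum>\<^sub>a z\<^sup>a F\<^sub>a(U)\<close> with \<open>z\<close> the increment of \<open>Z\<close>, and the scheme is the ordinary Runge-Kutta
method for this autonomous equation. The classical order theory then gives a local error of size
\<open>|z|\<^sup>p\<^sup>+\<^sup>1 \<le> C h\<^sub>n\<^sup>(\<^sup>p\<^sup>+\<^sup>1\<^sup>)\<^sup>\<alpha>\<close> (\<open>scrk_local_error\<close>). The Lipschitz bound on the flow transports the local errors
to a common time (\<open>flow_error_telescope\<close>), and their sum is at most a constant times \<open>h\<^sup>(\<^sup>p\<^sup>+\<^sup>1\<^sup>)\<^sup>\<alpha>\<^sup>-\<^sup>1\<close>
(\<open>powr_step_sum_le\<close>).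

The order theorem is proved without computing a B-series. Exact curve, stages and output of a step are
the values of one function \<open>V\<close> on a common set of nodes, and in each case \<open>V - y\<close> is an average of the field
along \<open>V\<close>: an integral over time, or a sum weighted by the tableau. Hence \<open>V\<close> has an expansion in products
of tree weights whose coefficients do not depend on the node (\<open>field_expansion\<close>), and if the weights of
all trees with at most \<open>p\<close> vertices agree at two nodes, the values of \<open>V\<close> there agree up to order \<open>p + 1\<close>
(\<open>order_conditions\<close>). For the end point of the exact curve the weights are \<open>1 / \<gamma>(\<tau>)\<close>, for the output they
are the step weights of the method, so this is precisely the assumption of tree order \<open>p\<close>.

The flow is defined by a description, so existence and uniqueness for Lipschitz equations are needed
to work with it; they are proved by Picard iteration and Gronwall's argument.\<close>

section \<open>Taylor polynomials of bounded smooth functions\<close>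

text \<open>A polynomial in \<open>v\<close> with coefficients depending on the base point \<open>y\<close>, kept as a list of monomials: the
pair \<open>(c, [b\<^sub>1, \<dots>, b\<^sub>k])\<close> stands for \<open>c y (v \<bullet> b\<^sub>1) \<cdots> (v \<bullet> b\<^sub>k)\<close>. Repeated monomials are allowed, so
no multinomial coefficients ever have to be collected.\<close>

definition taylor_sum :: "(('a::real_inner \<Rightarrow> real) \<times> 'a list) list \<Rightarrow> 'a \<Rightarrow> 'a \<Rightarrow> real" where
  "taylor_sum cs y v = (\<Sum>(c, J)\<leftarrow>cs. c y * (\<Prod>b\<leftarrow>J. v \<bullet> b))"

lemma taylor_sum_simps [simp]:
  "taylor_sum [] y v = 0"
  "taylor_sum ((c, J) # cs) y v = c y * (\<Prod>b\<leftarrow>J. v \<bullet> b) + taylor_sum cs y v"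
  "taylor_sum (cs @ ds) y v = taylor_sum cs y v + taylor_sum ds y v"
  by (simp_all add: taylor_sum_def)

lemma prod_list_inner_scaleR:
  "(\<Prod>b\<leftarrow>J. (s *\<^sub>R v) \<bullet> b) = s ^ length J * (\<Prod>b\<leftarrow>J. v \<bullet> b)"
  by (induction J) (simp_all add: algebra_simps)

text \<open>Along the ray \<open>s \<mapsto> s v\<close> a monomial of degree \<open>k\<close> grows like \<open>s\<^sup>k\<close>, so this is the antiderivative in \<open>s\<close>,
vanishing at \<open>s = 0\<close>, of \<open>v \<bullet> b\<close> times the polynomial.\<close>

definition taylor_int :: "'a::real_inner \<Rightarrow> (('a \<Rightarrow> real) \<times> 'a list) list \<Rightarrow> (('a \<Rightarrow> real) \<times> 'a list) list"
  where "taylor_int b cs = map (\<lambda>(c, J). (\<lambda>y. c y / real (Suc (length J)), b # J)) cs"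

lemma taylor_int_deriv:
  "((\<lambda>s. taylor_sum (taylor_int b cs) y (s *\<^sub>R v)) has_real_derivative
     (v \<bullet> b) * taylor_sum cs y (s *\<^sub>R v)) (at s)"
proof (induction cs)
  case Nil
  then show ?case by (simp add: taylor_int_def)
next
  case (Cons t cs)
  obtain c J where t: "t = (c, J)" by (cases t)
  define K where "K = c y / real (Suc (length J)) * ((v \<bullet> b) * (\<Prod>b\<leftarrow>J. v \<bullet> b))"
  have "((\<lambda>s. K * s ^ Suc (length J)) has_real_derivative K * (real (Suc (length J)) * s ^ length J)) (at s)"
    using DERIV_cmult[OF DERIV_pow[of "Suc (length J)" s UNIV], of K]
    by (simp only: diff_Suc_1 diff_Suc_Suc diff_zero)
  moreover have "K * (real (Suc (length J)) * s ^ length J)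
      = (v \<bullet> b) * (c y * (\<Prod>b\<leftarrow>J. (s *\<^sub>R v) \<bullet> b))"
    unfolding prod_list_inner_scaleR K_def by (simp add: field_simps del: of_nat_Suc)
  ultimately have deriv: "((\<lambda>s. K * s ^ Suc (length J)) has_real_derivative
      (v \<bullet> b) * (c y * (\<Prod>b\<leftarrow>J. (s *\<^sub>R v) \<bullet> b))) (at s)"
    by (simp only:)
  have eq: "(\<lambda>s. taylor_sum (taylor_int b (t # cs)) y (s *\<^sub>R v))
      = (\<lambda>s. K * s ^ Suc (length J) + taylor_sum (taylor_int b cs) y (s *\<^sub>R v))"
    unfolding t K_def
    by (intro ext)
       (simp add: taylor_int_def prod_list_inner_scaleR[unfolded inner_scaleR_left] algebra_simps)
  show ?case
    unfolding eq unfolding t taylor_sum_simps distrib_left by (rule DERIV_add[OF deriv Cons.IH])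
qed

lemma Cb_bounded: "Cb k f \<Longrightarrow> bounded (range f)"
  by (cases k) auto

lemma Cb_continuous: "Cb k f \<Longrightarrow> continuous_on UNIV f"
  by (cases k) (auto intro!: continuous_at_imp_continuous_on differentiable_imp_continuous_within)

lemma Cb_inner: "Cb k f \<Longrightarrow> Cb k (\<lambda>x. f x \<bullet> j)"
proof (induction k arbitrary: f)
  case 0
  then show ?case
    by (auto intro!: continuous_intros bounded_linear_image[OF _ bounded_linear_inner_left, of "range f" j, unfolded image_image])
next
  case (Suc k)
  have "frechet_derivative (\<lambda>x. f x \<bullet> j) (at x) = (\<lambda>v. frechet_derivative f (at x) v \<bullet> j)" for x
    using Suc.prems
    by (intro frechet_derivative_at[symmetric] has_derivative_inner_left)
       (simp add: frechet_derivative_works[symmetric])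
  moreover have "(\<lambda>x. f x \<bullet> j) differentiable (at x)" for x
    using Suc.prems by (auto intro: differentiable_compose[of "\<lambda>x. x \<bullet> j"] simp: bounded_linear_imp_differentiable bounded_linear_inner_left)
  ultimately show ?case
    using Suc by (auto intro!: bounded_linear_image[OF _ bounded_linear_inner_left, of "range f" j, unfolded image_image])
qed

lemma Cb_mono: "Cb k f \<Longrightarrow> l \<le> k \<Longrightarrow> Cb l f"
proof (induction l arbitrary: k f)
  case 0
  then show ?case using Cb_bounded Cb_continuous by auto
next
  case (Suc l)
  then obtain k' where "k = Suc k'" "l \<le> k'" by (cases k) auto
  with Suc show ?case by auto
qed

lemma Cb_Suc_lipschitz:
  assumes "Cb (Suc k) f"
  obtains L where "0 \<le> L" "\<And>x y. norm (f x - f y) \<le> L * norm (x - y)"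
proof -
  have "\<forall>b. \<exists>B. \<forall>x. norm (frechet_derivative f (at x) b) \<le> B"
    using assms Cb_bounded by (fastforce simp: bounded_iff)
  then obtain B where B: "\<And>b x. norm (frechet_derivative f (at x) b) \<le> B b" by metis
  have d: "(f has_derivative frechet_derivative f (at x)) (at x)" for x
    using assms by (simp add: frechet_derivative_works[symmetric])
  have "onorm (frechet_derivative f (at x)) \<le> (\<Sum>b\<in>Basis. B b)" for x
    using has_derivative_bounded_linear[OF d, of x] B
    by (intro order.trans[OF onorm_componentwise]) (auto intro: sum_mono)
  then have "norm (f x - f y) \<le> (\<Sum>b\<in>Basis. B b) * norm (x - y)" for x y
    using d by (intro differentiable_bound[of UNIV f "\<lambda>x. frechet_derivative f (at x)"]) auto
  moreover have "0 \<le> (\<Sum>b\<in>Basis. B b)"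
    by (intro sum_nonneg) (meson B norm_ge_zero order.trans)
  ultimately show thesis using that by blast
qed

text \<open>Induction on the order follows the recursion of \<^const>\<open>Cb\<close>: the partial derivatives of \<open>f\<close> have approximating
polynomials of one order less, these are integrated along the ray from \<open>y\<close> to \<open>y + v\<close>, and the mean
value theorem bounds the error that this integration leaves. Only the existence of coefficients that
are bounded uniformly in \<open>y\<close> matters below.\<close>

lemma Cb_taylor:
  fixes f :: "'a::euclidean_space \<Rightarrow> real"
  assumes "Cb N f"
  shows "\<exists>cs C. (\<forall>(c, J)\<in>set cs. bounded (range c) \<and> set J \<subseteq> Basis) \<and>
           (\<forall>y v. \<bar>f (y + v) - taylor_sum cs y v\<bar> \<le> C * norm v ^ N)"
  using assms
proof (induction N arbitrary: f)
  case 0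
  then obtain C where "\<And>x. \<bar>f x\<bar> \<le> C" by (auto simp: bounded_iff)
  then show ?case by (intro exI[of _ "[]"] exI[of _ C]) auto
next
  case (Suc N)
  let ?D = "\<lambda>b x. frechet_derivative f (at x) b"
  obtain bs :: "'a list" where bs: "set bs = Basis" "distinct bs"
    using finite_distinct_list[OF finite_Basis] by auto
  have "\<forall>b. \<exists>cs C. (\<forall>(c, J)\<in>set cs. bounded (range c) \<and> set J \<subseteq> Basis) \<and>
           (\<forall>y v. \<bar>?D b (y + v) - taylor_sum cs y v\<bar> \<le> C * norm v ^ N)"
    using Suc.prems by (intro allI Suc.IH) auto
  then obtain cs C where cs: "\<And>b c J. (c, J) \<in> set (cs b) \<Longrightarrow> bounded (range c) \<and> set J \<subseteq> Basis"
    and C: "\<And>b y v. \<bar>?D b (y + v) - taylor_sum (cs b) y v\<bar> \<le> C b * norm v ^ N"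
    unfolding choice_iff by (metis (no_types, lifting) case_prodD)
  define ds where "ds = (f, []) # concat (map (\<lambda>b. taylor_int b (cs b)) bs)"
  have ds_sum: "taylor_sum ds y v = f y + (\<Sum>b\<in>Basis. taylor_sum (taylor_int b (cs b)) y v)" for y v
  proof -
    have "taylor_sum (concat (map (\<lambda>b. taylor_int b (cs b)) bs')) y v
        = (\<Sum>b\<leftarrow>bs'. taylor_sum (taylor_int b (cs b)) y v)" for bs'
      by (induction bs') auto
    then show ?thesis
      using bs by (simp add: ds_def sum_list_distinct_conv_sum_set)
  qed
  have ok: "bounded (range c) \<and> set J \<subseteq> Basis" if cJ: "(c, J) \<in> set ds" for c J
  proof -
    have "bounded (range f)" using Suc.prems by simp
    moreover have "bounded (range (\<lambda>y. c' y / r))" if "bounded (range c')" for c' :: "'a \<Rightarrow> real" and r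
      using bounded_scaling[OF that, of "1/r"] by (simp add: image_image)
    moreover have "b \<in> Basis \<Longrightarrow> (c, J) \<in> set (taylor_int b (cs b)) \<Longrightarrow> bounded (range c) \<and> set J \<subseteq> Basis" for b
      using cs[of _ _ b] calculation(2) by (fastforce simp: taylor_int_def simp del: of_nat_Suc)
    ultimately show ?thesis
      using cJ bs by (auto simp: ds_def)
  qed
  have "\<bar>f (y + v) - taylor_sum ds y v\<bar> \<le> (\<Sum>b\<in>Basis. C b) * norm v ^ Suc N" for y v
  proof -
    let ?h = "\<lambda>s. f (y + s *\<^sub>R v) - taylor_sum ds y (s *\<^sub>R v)"
    let ?h' = "\<lambda>s. \<Sum>b\<in>Basis. (v \<bullet> b) * (?D b (y + s *\<^sub>R v) - taylor_sum (cs b) y (s *\<^sub>R v))"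
    have deriv: "(?h has_real_derivative ?h' s) (at s)" for s
    proof -
      have fd: "(f has_derivative (\<lambda>w. frechet_derivative f (at (y + s *\<^sub>R v)) w)) (at (y + s *\<^sub>R v))"
        using Suc.prems by (simp add: frechet_derivative_works[symmetric])
      have "((\<lambda>s. f (y + s *\<^sub>R v)) has_derivative
          (\<lambda>t. frechet_derivative f (at (y + s *\<^sub>R v)) (t *\<^sub>R v))) (at s)"
        by (rule has_derivative_compose[where f = "\<lambda>s. y + s *\<^sub>R v" and g = f, OF _ fd])
           (auto intro!: derivative_eq_intros)
      moreover have lin: "linear (frechet_derivative f (at (y + s *\<^sub>R v)))"
        using fd has_derivative_linear by auto
      moreover have "frechet_derivative f (at (y + s *\<^sub>R v)) v = (\<Sum>b\<in>Basis. (v \<bullet> b) * ?D b (y + s *\<^sub>R v))"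
        by (subst (2) euclidean_representation[of v, symmetric])
           (simp add: linear_sum[OF lin] linear_scale[OF lin])
      ultimately have 1: "((\<lambda>s. f (y + s *\<^sub>R v)) has_real_derivative
          (\<Sum>b\<in>Basis. (v \<bullet> b) * ?D b (y + s *\<^sub>R v))) (at s)"
        by (simp add: has_field_derivative_def linear_scale[OF lin] mult_commute_abs)
      have 2: "((\<lambda>s. taylor_sum ds y (s *\<^sub>R v)) has_real_derivative
          (\<Sum>b\<in>Basis. (v \<bullet> b) * taylor_sum (cs b) y (s *\<^sub>R v))) (at s)"
        unfolding ds_sum using DERIV_add[OF DERIV_const DERIV_sum[OF taylor_int_deriv]] by simp
      show ?thesis
        using DERIV_diff[OF 1 2] by (simp add: sum_subtractf algebra_simps)
    qed
    obtain s where s: "0 < s" "s < 1" "?h 1 - ?h 0 = (1 - 0) * ?h' s"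
      using MVT2[of 0 1 ?h ?h'] deriv by auto
    have "?h 0 = 0"
    proof -
      have "taylor_sum (taylor_int b cs') y 0 = 0" for b cs'
        by (induction cs') (auto simp: taylor_int_def)
      then show ?thesis by (simp add: ds_sum)
    qed
    then have "f (y + v) - taylor_sum ds y v = ?h' s" using s(3) by simp
    moreover have "\<bar>?h' s\<bar> \<le> (\<Sum>b\<in>Basis. norm v * (C b * norm v ^ N))"
    proof (intro order.trans[OF sum_abs] sum_mono)
      fix b :: 'a assume b: "b \<in> Basis"
      have C0: "0 \<le> C b"
        using order.trans[OF abs_ge_zero C[where b = b and v = b]] b by simp
      have "\<bar>?D b (y + s *\<^sub>R v) - taylor_sum (cs b) y (s *\<^sub>R v)\<bar> \<le> C b * norm (s *\<^sub>R v) ^ N" by (rule C)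
      also have "\<dots> \<le> C b * norm v ^ N"
        using s C0 by (intro mult_left_mono power_mono) (auto simp: mult_left_le_one_le)
      finally show "\<bar>(v \<bullet> b) * (?D b (y + s *\<^sub>R v) - taylor_sum (cs b) y (s *\<^sub>R v))\<bar> \<le> norm v * (C b * norm v ^ N)"
        unfolding abs_mult using b by (intro mult_mono) (auto simp: Basis_le_norm)
    qed
    ultimately show ?thesis
      by (simp add: sum_distrib_right sum_distrib_left algebra_simps)
  qed
  with ok show ?case by (intro exI[of _ ds] exI[of _ "\<Sum>b\<in>Basis. C b"]) auto
qed

section \<open>Expansions in tree weights\<close>

definition forest_size :: "'m rtree multiset \<Rightarrow> nat" where
  "forest_size ts = \<Sum>\<^sub># (image_mset vertices ts)"

lemma forest_size_simps [simp]:
  "forest_size {#} = 0" "forest_size {#t#} = vertices t" "forest_size (ts + us) = forest_size ts + forest_size us"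
  by (simp_all add: forest_size_def)

lemma vertices_Node: "vertices (Node a ts) = Suc (forest_size ts)"
  by (simp add: forest_size_def)

text \<open>A calculus of expansions in powers of a small quantity \<open>eps \<theta>\<close>, uniform in a parameter \<open>\<theta>\<close> (data of one
step of the method) and in a node \<open>x\<close> (a time of the exact curve, a stage or the output). The
functions of \<open>x\<close> that occur are products of tree weights \<open>w x \<tau>\<close>. Keeping exact and numerical
quantities in one family forces them to share the coefficients of their expansions; the coefficients
themselves need never be computed.\<close>

locale weighted_forests =
  fixes \<Theta> :: "'t set" and \<Omega> :: "'w set" and eps :: "'t \<Rightarrow> real" and M :: real
    and w :: "'w \<Rightarrow> 'm rtree \<Rightarrow> real"
  assumes eps_nonneg: "\<theta> \<in> \<Theta> \<Longrightarrow> 0 \<le> eps \<theta>" and eps_le: "\<theta> \<in> \<Theta> \<Longrightarrow> eps \<theta> \<le> M"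
    and \<Omega>_nonempty: "\<Omega> \<noteq> {}"
    and w_bounded: "\<exists>C. \<forall>x\<in>\<Omega>. \<bar>w x \<tau>\<bar> \<le> C"
begin

definition forest_weight :: "'w \<Rightarrow> 'm rtree multiset \<Rightarrow> real" where
  "forest_weight x ts = prod_mset (image_mset (w x) ts)"

definition of_order :: "nat \<Rightarrow> ('t \<Rightarrow> 'w \<Rightarrow> real) \<Rightarrow> bool" where
  "of_order N f \<longleftrightarrow> (\<exists>C. \<forall>\<theta>\<in>\<Theta>. \<forall>x\<in>\<Omega>. \<bar>f \<theta> x\<bar> \<le> C * eps \<theta> ^ N)"

lemma orderE:
  assumes "of_order N f"
  obtains C where "0 \<le> C" "\<And>\<theta> x. \<theta> \<in> \<Theta> \<Longrightarrow> x \<in> \<Omega> \<Longrightarrow> \<bar>f \<theta> x\<bar> \<le> C * eps \<theta> ^ N"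
proof -
  obtain C where C: "\<And>\<theta> x. \<theta> \<in> \<Theta> \<Longrightarrow> x \<in> \<Omega> \<Longrightarrow> \<bar>f \<theta> x\<bar> \<le> C * eps \<theta> ^ N"
    using assms by (auto simp: of_order_def)
  have "\<bar>f \<theta> x\<bar> \<le> \<bar>C\<bar> * eps \<theta> ^ N" if "\<theta> \<in> \<Theta>" "x \<in> \<Omega>" for \<theta> x
    by (rule order.trans[OF C[OF that]]) (simp add: mult_right_mono eps_nonneg that)
  then show thesis using that[of "\<bar>C\<bar>"] by simp
qed

lemma orderI: "(\<And>\<theta> x. \<theta> \<in> \<Theta> \<Longrightarrow> x \<in> \<Omega> \<Longrightarrow> \<bar>f \<theta> x\<bar> \<le> C * eps \<theta> ^ N) \<Longrightarrow> of_order N f"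
  unfolding of_order_def by blast

lemma order_zero: "of_order N (\<lambda>\<theta> x. 0)"
  by (rule orderI[of _ 0]) simp

lemma order_add:
  assumes "of_order N f" "of_order N g"
  shows "of_order N (\<lambda>\<theta> x. f \<theta> x + g \<theta> x)"
proof -
  obtain C where C: "0 \<le> C" "\<And>\<theta> x. \<theta> \<in> \<Theta> \<Longrightarrow> x \<in> \<Omega> \<Longrightarrow> \<bar>f \<theta> x\<bar> \<le> C * eps \<theta> ^ N" using assms(1) by (rule orderE) blast
  obtain D where D: "0 \<le> D" "\<And>\<theta> x. \<theta> \<in> \<Theta> \<Longrightarrow> x \<in> \<Omega> \<Longrightarrow> \<bar>g \<theta> x\<bar> \<le> D * eps \<theta> ^ N" using assms(2) by (rule orderE) blast
  show ?thesis
  proof (rule orderI[of _ "C + D"])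
    fix \<theta> x assume "\<theta> \<in> \<Theta>" "x \<in> \<Omega>"
    from C(2)[OF this] D(2)[OF this] show "\<bar>f \<theta> x + g \<theta> x\<bar> \<le> (C + D) * eps \<theta> ^ N"
      unfolding distrib_right by linarith
  qed
qed

lemma order_mult:
  assumes "of_order N f" "of_order K g"
  shows "of_order (N + K) (\<lambda>\<theta> x. f \<theta> x * g \<theta> x)"
proof -
  obtain C where C: "0 \<le> C" "\<And>\<theta> x. \<theta> \<in> \<Theta> \<Longrightarrow> x \<in> \<Omega> \<Longrightarrow> \<bar>f \<theta> x\<bar> \<le> C * eps \<theta> ^ N" using assms(1) by (rule orderE) blast
  obtain D where D: "0 \<le> D" "\<And>\<theta> x. \<theta> \<in> \<Theta> \<Longrightarrow> x \<in> \<Omega> \<Longrightarrow> \<bar>g \<theta> x\<bar> \<le> D * eps \<theta> ^ K" using assms(2) by (rule orderE) blast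
  show ?thesis
  proof (rule orderI[of _ "C * D"])
    fix \<theta> x assume *: "\<theta> \<in> \<Theta>" "x \<in> \<Omega>"
    have "\<bar>f \<theta> x\<bar> * \<bar>g \<theta> x\<bar> \<le> (C * eps \<theta> ^ N) * (D * eps \<theta> ^ K)"
      using C D * by (intro mult_mono) (auto simp: eps_nonneg)
    then show "\<bar>f \<theta> x * g \<theta> x\<bar> \<le> C * D * eps \<theta> ^ (N + K)" by (simp add: abs_mult power_add algebra_simps)
  qed
qed

lemma order_weaken:
  assumes "of_order N f" "K \<le> N"
  shows "of_order K f"
proof -
  obtain C where C: "0 \<le> C" "\<And>\<theta> x. \<theta> \<in> \<Theta> \<Longrightarrow> x \<in> \<Omega> \<Longrightarrow> \<bar>f \<theta> x\<bar> \<le> C * eps \<theta> ^ N" using assms(1) by (rule orderE) blast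
  show ?thesis
  proof (rule orderI[of _ "C * M ^ (N - K)"])
    fix \<theta> x assume *: "\<theta> \<in> \<Theta>" "x \<in> \<Omega>"
    have "eps \<theta> ^ N = eps \<theta> ^ (N - K) * eps \<theta> ^ K" using assms(2) by (simp flip: power_add)
    also have "\<dots> \<le> M ^ (N - K) * eps \<theta> ^ K"
      using * eps_nonneg eps_le by (intro mult_right_mono power_mono) auto
    finally show "\<bar>f \<theta> x\<bar> \<le> C * M ^ (N - K) * eps \<theta> ^ K"
      using C(2)[OF *] C(1) by (metis mult.assoc mult_left_mono order.trans)
  qed
qed

lemma order_weight: "of_order 0 (\<lambda>\<theta> x. forest_weight x ts)"
proof (induction ts)
  case empty
  show ?case by (rule orderI[of _ 1]) (simp add: forest_weight_def)
next
  case (add t ts)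
  obtain C where "\<forall>x\<in>\<Omega>. \<bar>w x t\<bar> \<le> C" using w_bounded by blast
  then have "of_order 0 (\<lambda>\<theta> x. w x t)" by (intro orderI[of _ C]) simp
  from order_mult[OF this add] show ?case by (simp add: forest_weight_def)
qed

definition forest_sum :: "(('t \<Rightarrow> real) \<times> 'm rtree multiset) list \<Rightarrow> 't \<Rightarrow> 'w \<Rightarrow> real" where
  "forest_sum cs \<theta> x = (\<Sum>(c, ts)\<leftarrow>cs. c \<theta> * forest_weight x ts)"

lemma forest_sum_simps [simp]:
  "forest_sum [] \<theta> x = 0"
  "forest_sum ((c, ts) # cs) \<theta> x = c \<theta> * forest_weight x ts + forest_sum cs \<theta> x"
  "forest_sum (cs @ ds) \<theta> x = forest_sum cs \<theta> x + forest_sum ds \<theta> x"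
  by (simp_all add: forest_sum_def)

text \<open>The coefficient of a forest with \<open>n\<close> vertices has size \<open>eps\<^sup>n\<^sup>+\<^sup>r\<close>. The surplus \<open>r = 1\<close> is what the vector
field picks up when it is multiplied by an increment of the driver; it is used up when the forest is
joined to a new root.\<close>

definition graded :: "nat \<Rightarrow> (('t \<Rightarrow> real) \<times> 'm rtree multiset) list \<Rightarrow> bool" where
  "graded r cs \<longleftrightarrow> (\<forall>(c, ts)\<in>set cs. of_order (forest_size ts + r) (\<lambda>\<theta> x. c \<theta>))"

lemma graded_simps [simp]:
  "graded r []"
  "graded r ((c, ts) # cs) \<longleftrightarrow> of_order (forest_size ts + r) (\<lambda>\<theta> x. c \<theta>) \<and> graded r cs"
  "graded r (cs @ ds) \<longleftrightarrow> graded r cs \<and> graded r ds"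
  by (auto simp: graded_def)

text \<open>No term is ever truncated: a forest with \<open>N\<close> or more vertices may well occur in the sum, where it is
harmless.\<close>

definition expands :: "nat \<Rightarrow> nat \<Rightarrow> ('t \<Rightarrow> 'w \<Rightarrow> real) \<Rightarrow> bool" where
  "expands r N W \<longleftrightarrow> (\<exists>cs. graded r cs \<and> of_order N (\<lambda>\<theta> x. W \<theta> x - forest_sum cs \<theta> x))"

lemma order_forest_sum: "graded r cs \<Longrightarrow> of_order r (forest_sum cs)"
proof (induction cs)
  case Nil
  then show ?case using order_zero by (simp add: forest_sum_def)
next
  case (Cons t cs)
  obtain c ts where t: "t = (c, ts)" by (cases t)
  have "of_order (forest_size ts + r) (\<lambda>\<theta> x. c \<theta> * forest_weight x ts)"
    using Cons.prems order_mult[OF _ order_weight, of _ "\<lambda>\<theta> x. c \<theta>"] by (simp add: t)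
  then have "of_order r (\<lambda>\<theta> x. c \<theta> * forest_weight x ts)" by (rule order_weaken) simp
  with Cons show ?case by (simp add: t fun_eq_iff order_add[of r _ "forest_sum cs"])
qed

lemma expands_bounded:
  assumes "expands 0 N W"
  shows "of_order 0 W"
proof -
  obtain cs where "graded 0 cs" "of_order N (\<lambda>\<theta> x. W \<theta> x - forest_sum cs \<theta> x)"
    using assms by (auto simp: expands_def)
  then have "of_order 0 (\<lambda>\<theta> x. (W \<theta> x - forest_sum cs \<theta> x) + forest_sum cs \<theta> x)"
    by (intro order_add order_forest_sum) (auto intro: order_weaken)
  then show ?thesis by simp
qed

lemma expands_remainder: "of_order N W \<Longrightarrow> expands r N W"
  unfolding expands_def by (rule exI[of _ "[]"]) simp

lemma expands_add:
  assumes "expands r N V" "expands r N W"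
  shows "expands r N (\<lambda>\<theta> x. V \<theta> x + W \<theta> x)"
proof -
  obtain cs where cs: "graded r cs" "of_order N (\<lambda>\<theta> x. V \<theta> x - forest_sum cs \<theta> x)"
    using assms(1) by (auto simp: expands_def)
  obtain ds where ds: "graded r ds" "of_order N (\<lambda>\<theta> x. W \<theta> x - forest_sum ds \<theta> x)"
    using assms(2) by (auto simp: expands_def)
  show ?thesis
    unfolding expands_def using order_add[OF cs(2) ds(2)] cs(1) ds(1)
    by (intro exI[of _ "cs @ ds"]) (simp add: algebra_simps)
qed

lemma expands_sum:
  "finite I \<Longrightarrow> (\<And>i. i \<in> I \<Longrightarrow> expands r N (W i)) \<Longrightarrow> expands r N (\<lambda>\<theta> x. \<Sum>i\<in>I. W i \<theta> x)"
  by (induction I rule: finite_induct) (auto intro: expands_add expands_remainder order_zero)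

lemma expands_const:
  assumes "of_order 0 (\<lambda>\<theta> x. c \<theta>)"
  shows "expands 0 N (\<lambda>\<theta> x. c \<theta>)"
  unfolding expands_def
  by (rule exI[of _ "[(c, {#})]"]) (use assms in \<open>simp add: forest_weight_def order_zero\<close>)

definition forest_prod ::
  "(('t \<Rightarrow> real) \<times> 'm rtree multiset) list \<Rightarrow> (('t \<Rightarrow> real) \<times> 'm rtree multiset) list
     \<Rightarrow> (('t \<Rightarrow> real) \<times> 'm rtree multiset) list" where
  "forest_prod cs ds = concat (map (\<lambda>(c, ts). map (\<lambda>(d, us). (\<lambda>\<theta>. c \<theta> * d \<theta>, ts + us)) ds) cs)"

lemma forest_sum_prod: "forest_sum (forest_prod cs ds) \<theta> x = forest_sum cs \<theta> x * forest_sum ds \<theta> x"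
proof (induction cs)
  case (Cons t cs)
  obtain c ts where t: "t = (c, ts)" by (cases t)
  have "forest_sum (map (\<lambda>(d, us). (\<lambda>\<theta>. c \<theta> * d \<theta>, ts + us)) ds) \<theta> x
      = c \<theta> * forest_weight x ts * forest_sum ds \<theta> x"
    by (induction ds) (auto simp: forest_weight_def algebra_simps)
  with Cons show ?case by (simp add: forest_prod_def t algebra_simps)
qed (simp add: forest_prod_def)

lemma graded_prod:
  assumes "graded r cs" "graded s ds"
  shows "graded (r + s) (forest_prod cs ds)"
proof -
  have "of_order (forest_size (ts + us) + (r + s)) (\<lambda>\<theta> x. c \<theta> * d \<theta>)"
    if "(c, ts) \<in> set cs" "(d, us) \<in> set ds" for c ts d us
    using order_mult[of "forest_size ts + r" "\<lambda>\<theta> x. c \<theta>" "forest_size us + s" "\<lambda>\<theta> x. d \<theta>"] assms that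
    by (fastforce simp: graded_def algebra_simps)
  then show ?thesis by (fastforce simp: graded_def forest_prod_def)
qed

text \<open>This is where forests rather than trees are needed: the product of the weights of two forests is the
weight of their union.\<close>

lemma expands_mult:
  assumes V: "expands 0 N V" and W: "expands 0 N W"
  shows "expands 0 N (\<lambda>\<theta> x. V \<theta> x * W \<theta> x)"
proof -
  obtain cs where cs: "graded 0 cs" "of_order N (\<lambda>\<theta> x. V \<theta> x - forest_sum cs \<theta> x)"
    using V by (auto simp: expands_def)
  obtain ds where ds: "graded 0 ds" "of_order N (\<lambda>\<theta> x. W \<theta> x - forest_sum ds \<theta> x)"
    using W by (auto simp: expands_def)
  have "of_order N (\<lambda>\<theta> x. V \<theta> x * (W \<theta> x - forest_sum ds \<theta> x))"
    using order_mult[OF expands_bounded[OF V] ds(2)] by simp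
  moreover have "of_order N (\<lambda>\<theta> x. (V \<theta> x - forest_sum cs \<theta> x) * forest_sum ds \<theta> x)"
    using order_mult[OF cs(2) order_forest_sum[OF ds(1)]] by simp
  ultimately have "of_order N (\<lambda>\<theta> x. V \<theta> x * (W \<theta> x - forest_sum ds \<theta> x)
      + (V \<theta> x - forest_sum cs \<theta> x) * forest_sum ds \<theta> x)"
    by (rule order_add)
  then have "of_order N (\<lambda>\<theta> x. V \<theta> x * W \<theta> x - forest_sum (forest_prod cs ds) \<theta> x)"
    by (simp add: forest_sum_prod algebra_simps)
  then show ?thesis
    unfolding expands_def using graded_prod[OF cs(1) ds(1)] by auto
qed

lemma expands_prod_list:
  "(\<And>b. b \<in> set J \<Longrightarrow> expands 0 N (W b)) \<Longrightarrow> expands 0 N (\<lambda>\<theta> x. \<Prod>b\<leftarrow>J. W b \<theta> x)"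
proof (induction J)
  case Nil
  show ?case using expands_const[of "\<lambda>_. 1"] orderI[of "\<lambda>_ _. 1" 1 0] by simp
qed (simp add: expands_mult)

lemma expands_scale:
  assumes c: "of_order 1 (\<lambda>\<theta> x. c \<theta>)" and W: "expands 0 N W"
  shows "expands 1 (Suc N) (\<lambda>\<theta> x. c \<theta> * W \<theta> x)"
proof -
  obtain cs where cs: "graded 0 cs" "of_order N (\<lambda>\<theta> x. W \<theta> x - forest_sum cs \<theta> x)"
    using W by (auto simp: expands_def)
  have "of_order (Suc N) (\<lambda>\<theta> x. c \<theta> * (W \<theta> x - forest_sum cs \<theta> x))"
    using order_mult[OF c cs(2)] by simp
  moreover have "forest_sum (forest_prod [(c, {#})] cs) \<theta> x = c \<theta> * forest_sum cs \<theta> x" for \<theta> x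
    by (simp only: forest_sum_prod) (simp add: forest_weight_def)
  ultimately show ?thesis
    using graded_prod[of 1 "[(c, {#})]" 0 cs] c cs(1)
    unfolding expands_def by (intro exI[of _ "forest_prod [(c, {#})] cs"]) (simp add: algebra_simps)
qed

text \<open>Taylor's theorem turns a smooth function of \<open>V\<close> into a polynomial in the components of \<open>V - y\<close>, and
polynomials preserve expansions. Since \<open>V - y\<close> is of first order, the Taylor remainder has order \<open>N\<close>.\<close>

lemma expands_compose:
  fixes V :: "'t \<Rightarrow> 'w \<Rightarrow> 'a::euclidean_space"
  assumes g: "Cb N g"
    and V: "\<And>j. j \<in> Basis \<Longrightarrow> expands 0 N (\<lambda>\<theta> x. (V \<theta> x - y \<theta>) \<bullet> j)"
    and small: "of_order 1 (\<lambda>\<theta> x. norm (V \<theta> x - y \<theta>))"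
  shows "expands 0 N (\<lambda>\<theta> x. g (V \<theta> x))"
proof -
  obtain cs C where cs: "\<forall>(c, J)\<in>set cs. bounded (range c) \<and> set J \<subseteq> Basis"
    and C: "\<And>y v. \<bar>g (y + v) - taylor_sum cs y v\<bar> \<le> C * norm v ^ N"
    using Cb_taylor[OF g] by blast
  have main: "expands 0 N (\<lambda>\<theta> x. taylor_sum cs (y \<theta>) (V \<theta> x - y \<theta>))"
    using cs
  proof (induction cs)
    case Nil
    then show ?case by (simp add: expands_remainder order_zero)
  next
    case (Cons t cs)
    obtain c J where t: "t = (c, J)" by (cases t)
    obtain B where "\<And>y. \<bar>c y\<bar> \<le> B" using Cons.prems by (auto simp: t bounded_iff)
    then have coeff: "expands 0 N (\<lambda>\<theta> x. c (y \<theta>))"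
      by (intro expands_const orderI[of _ B]) simp
    have prod: "expands 0 N (\<lambda>\<theta> x. \<Prod>b\<leftarrow>J. (V \<theta> x - y \<theta>) \<bullet> b)"
      using Cons.prems V by (intro expands_prod_list) (auto simp: t)
    have IH: "expands 0 N (\<lambda>\<theta> x. taylor_sum cs (y \<theta>) (V \<theta> x - y \<theta>))"
      using Cons by simp
    show ?case
      unfolding t taylor_sum_simps by (rule expands_add[OF expands_mult[OF coeff prod] IH])
  qed
  have remainder: "of_order N (\<lambda>\<theta> x. g (V \<theta> x) - taylor_sum cs (y \<theta>) (V \<theta> x - y \<theta>))"
  proof -
    have pow: "of_order N (\<lambda>\<theta> x. norm (V \<theta> x - y \<theta>) ^ N)" for N
    proof (induction N)
      case 0
      show ?case by (rule orderI[of _ 1]) simp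
    qed (use order_mult[OF small] in simp)
    obtain D where D: "0 \<le> D" "\<And>\<theta> x. \<theta> \<in> \<Theta> \<Longrightarrow> x \<in> \<Omega> \<Longrightarrow> norm (V \<theta> x - y \<theta>) ^ N \<le> D * eps \<theta> ^ N"
      using pow[of N] by (elim orderE) auto
    show ?thesis
    proof (rule orderI[of _ "\<bar>C\<bar> * D"])
      fix \<theta> x assume *: "\<theta> \<in> \<Theta>" "x \<in> \<Omega>"
      have "\<bar>g (V \<theta> x) - taylor_sum cs (y \<theta>) (V \<theta> x - y \<theta>)\<bar> \<le> C * norm (V \<theta> x - y \<theta>) ^ N"
        using C[of "y \<theta>" "V \<theta> x - y \<theta>"] by simp
      also have "\<dots> \<le> \<bar>C\<bar> * norm (V \<theta> x - y \<theta>) ^ N" by (simp add: mult_right_mono)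
      also have "\<dots> \<le> \<bar>C\<bar> * (D * eps \<theta> ^ N)" using D * by (intro mult_left_mono) auto
      finally show "\<bar>g (V \<theta> x) - taylor_sum cs (y \<theta>) (V \<theta> x - y \<theta>)\<bar> \<le> \<bar>C\<bar> * D * eps \<theta> ^ N" by simp
    qed
  qed
  show ?thesis
    using expands_add[OF main expands_remainder[OF remainder]] by simp
qed

text \<open>Grafting each forest onto a new root. One fixed decoration for all roots suffices: the components of
the driver have already been summed up in the coefficients, and the order conditions hold for every
decoration.\<close>

definition tree_sum :: "(('t \<Rightarrow> real) \<times> 'm rtree multiset) list \<Rightarrow> 't \<Rightarrow> 'w \<Rightarrow> real" where
  "tree_sum cs \<theta> x = (\<Sum>(c, ts)\<leftarrow>cs. c \<theta> * w x (Node undefined ts))"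

lemma tree_sum_simps [simp]:
  "tree_sum [] \<theta> x = 0"
  "tree_sum ((c, ts) # cs) \<theta> x = c \<theta> * w x (Node undefined ts) + tree_sum cs \<theta> x"
  by (simp_all add: tree_sum_def)

lemma order_tree_sum: "graded 1 cs \<Longrightarrow> of_order 1 (tree_sum cs)"
proof (induction cs)
  case Nil
  then show ?case using order_zero[of 1] by (simp add: tree_sum_def)
next
  case (Cons t cs)
  obtain c ts where t: "t = (c, ts)" by (cases t)
  have c: "of_order (forest_size ts + 1) (\<lambda>\<theta> x. c \<theta>)" and "of_order 1 (tree_sum cs)"
    using Cons by (simp_all add: t)
  have "of_order (forest_size ts + 1) (\<lambda>\<theta> x. c \<theta> * w x (Node undefined ts))"
    using order_mult[OF c order_weight[of "{#Node undefined ts#}"]] by (simp add: forest_weight_def)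
  then have "of_order 1 (\<lambda>\<theta> x. c \<theta> * w x (Node undefined ts))"
    by (rule order_weaken) simp
  from order_add[OF this \<open>of_order 1 (tree_sum cs)\<close>] show ?case
    by (simp add: t tree_sum_def)
qed

lemma expands_tree_sum: "graded 1 cs \<Longrightarrow> expands 0 N (tree_sum cs)"
proof -
  let ?ds = "map (\<lambda>(c, ts). (c, {#Node undefined ts#})) cs"
  assume "graded 1 cs"
  then have "graded 0 ?ds" by (induction cs) (auto simp: vertices_Node simp del: vertices.simps)
  moreover have "forest_sum ?ds \<theta> x = tree_sum cs \<theta> x" for \<theta> x
    by (induction cs) (auto simp: forest_weight_def)
  ultimately show ?thesis
    unfolding expands_def by (intro exI[of _ ?ds]) (simp add: order_zero)
qed

end

text \<open>Curves \<open>V \<theta>\<close> on the nodes that arise from the field \<open>\<Sum>\<^sub>a z\<^sup>a F\<^sub>a(V)\<close> by a bounded linear averaging: integration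
over time for an exact solution, multiplication by the tableau for stages and output. The assumption
\<open>stage\<close> says this without naming the averaging: it maps forest weights to the weights of the grafted
trees and its norm is at most \<open>K\<close>.\<close>

locale runge_kutta_family = weighted_forests \<Theta> \<Omega> "\<lambda>\<theta>. norm (z \<theta>)" M w
  for \<Theta> :: "'t set" and \<Omega> :: "'w set" and z :: "'t \<Rightarrow> real^'m" and M :: real
    and w :: "'w \<Rightarrow> 'm rtree \<Rightarrow> real" +
  fixes F :: "'m \<Rightarrow> real^'e \<Rightarrow> real^'e" and y :: "'t \<Rightarrow> real^'e" and V :: "'t \<Rightarrow> 'w \<Rightarrow> real^'e"
    and p :: nat and K :: real
  assumes F: "Cb p (F a)"
    and stage: "\<theta> \<in> \<Theta> \<Longrightarrow> j \<in> Basis \<Longrightarrow>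
      (\<And>x. x \<in> \<Omega> \<Longrightarrow> \<bar>(\<Sum>a\<in>UNIV. z \<theta> $ a * (F a (V \<theta> x) \<bullet> j)) - forest_sum cs \<theta> x\<bar> \<le> \<delta>) \<Longrightarrow>
      x \<in> \<Omega> \<Longrightarrow> \<bar>(V \<theta> x - y \<theta>) \<bullet> j - tree_sum cs \<theta> x\<bar> \<le> K * \<delta>"
begin

lemma stage_expansion:
  assumes "\<And>a. expands 0 N (\<lambda>\<theta> x. F a (V \<theta> x) \<bullet> j)" and j: "j \<in> Basis"
  shows "\<exists>cs. graded 1 cs \<and> of_order (Suc N) (\<lambda>\<theta> x. (V \<theta> x - y \<theta>) \<bullet> j - tree_sum cs \<theta> x)"
proof -
  have "expands 1 (Suc N) (\<lambda>\<theta> x. \<Sum>a\<in>UNIV. z \<theta> $ a * (F a (V \<theta> x) \<bullet> j))"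
    by (intro expands_sum expands_scale assms orderI[of _ 1]) (auto simp: component_le_norm_cart)
  then obtain cs where cs: "graded 1 cs"
    "of_order (Suc N) (\<lambda>\<theta> x. (\<Sum>a\<in>UNIV. z \<theta> $ a * (F a (V \<theta> x) \<bullet> j)) - forest_sum cs \<theta> x)"
    by (auto simp: expands_def)
  then obtain C where C: "\<And>\<theta> x. \<theta> \<in> \<Theta> \<Longrightarrow> x \<in> \<Omega> \<Longrightarrow>
      \<bar>(\<Sum>a\<in>UNIV. z \<theta> $ a * (F a (V \<theta> x) \<bullet> j)) - forest_sum cs \<theta> x\<bar> \<le> C * norm (z \<theta>) ^ Suc N"
    by (elim orderE) auto
  have "\<bar>(V \<theta> x - y \<theta>) \<bullet> j - tree_sum cs \<theta> x\<bar> \<le> K * C * norm (z \<theta>) ^ Suc N"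
    if "\<theta> \<in> \<Theta>" "x \<in> \<Omega>" for \<theta> x
    using stage[OF that(1) j C that(2)] that by (simp add: mult.assoc)
  then have "of_order (Suc N) (\<lambda>\<theta> x. (V \<theta> x - y \<theta>) \<bullet> j - tree_sum cs \<theta> x)" by (rule orderI)
  with cs(1) show ?thesis by blast
qed

text \<open>Bootstrapping: an expansion of the field to order \<open>N\<close> gives one of \<open>V - y\<close> to order \<open>N + 1\<close> by averaging,
and Taylor's theorem carries this back to the field. The start \<open>N = 0\<close> is the boundedness of the field.\<close>

lemma field_expansion: "N \<le> p \<Longrightarrow> expands 0 N (\<lambda>\<theta> x. F a (V \<theta> x) \<bullet> j)"
proof (induction N arbitrary: a j)
  case 0
  obtain B where "\<And>x. \<bar>F a x \<bullet> j\<bar> \<le> B"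
    using Cb_bounded[OF Cb_inner[OF F[of a], of j]] by (auto simp: bounded_iff)
  then show ?case by (intro expands_remainder orderI[of _ B]) simp
next
  case (Suc N)
  have IH: "expands 0 N (\<lambda>\<theta> x. F a (V \<theta> x) \<bullet> j)" for a j using Suc by simp
  have V: "expands 0 (Suc N) (\<lambda>\<theta> x. (V \<theta> x - y \<theta>) \<bullet> j)" if j': "j \<in> Basis" for j
  proof -
    obtain cs where "graded 1 cs" "of_order (Suc N) (\<lambda>\<theta> x. (V \<theta> x - y \<theta>) \<bullet> j - tree_sum cs \<theta> x)"
      using stage_expansion[OF IH j'] by blast
    then show ?thesis
      using expands_add[OF expands_remainder[of "Suc N" "\<lambda>\<theta> x. (V \<theta> x - y \<theta>) \<bullet> j - tree_sum cs \<theta> x"]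
            expands_tree_sum[of cs "Suc N"]] by simp
  qed
  have "of_order 1 (\<lambda>\<theta> x. norm (V \<theta> x - y \<theta>))"
  proof -
    have "\<exists>C. \<forall>\<theta>\<in>\<Theta>. \<forall>x\<in>\<Omega>. \<bar>(V \<theta> x - y \<theta>) \<bullet> j\<bar> \<le> C * norm (z \<theta>)" if j: "j \<in> Basis" for j
    proof -
      have 0: "of_order 0 (\<lambda>\<theta> x. F a (V \<theta> x) \<bullet> j)" for a
        using expands_bounded[OF IH] .
      then obtain cs where cs: "graded 1 cs" "of_order 1 (\<lambda>\<theta> x. (V \<theta> x - y \<theta>) \<bullet> j - tree_sum cs \<theta> x)"
        using stage_expansion[of 0 j] j expands_remainder[OF 0] by auto
      from order_add[OF cs(2) order_tree_sum[OF cs(1)]]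
      have "of_order 1 (\<lambda>\<theta> x. (V \<theta> x - y \<theta>) \<bullet> j)" by simp
      then show ?thesis by (simp add: of_order_def)
    qed
    then obtain C where C: "\<And>j \<theta> x. j \<in> Basis \<Longrightarrow> \<theta> \<in> \<Theta> \<Longrightarrow> x \<in> \<Omega> \<Longrightarrow>
        \<bar>(V \<theta> x - y \<theta>) \<bullet> j\<bar> \<le> C j * norm (z \<theta>)"
      by metis
    show ?thesis
    proof (rule orderI[of _ "\<Sum>j\<in>Basis. C j"])
      fix \<theta> x assume *: "\<theta> \<in> \<Theta>" "x \<in> \<Omega>"
      have "norm (V \<theta> x - y \<theta>) \<le> (\<Sum>j\<in>Basis. \<bar>(V \<theta> x - y \<theta>) \<bullet> j\<bar>)" by (rule norm_le_l1)
      also have "\<dots> \<le> (\<Sum>j\<in>Basis. C j * norm (z \<theta>))" using C * by (intro sum_mono) auto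
      finally show "\<bar>norm (V \<theta> x - y \<theta>)\<bar> \<le> (\<Sum>j\<in>Basis. C j) * norm (z \<theta>) ^ 1"
        by (simp add: sum_distrib_right)
    qed
  qed
  then show ?case
    using expands_compose[OF Cb_inner[OF Cb_mono[OF F Suc.prems]] V] by simp
qed

text \<open>At two nodes the expansions of \<open>V\<close> have the same coefficients, so trees on which the weights agree
cancel. The trees with at most \<open>p\<close> vertices are among these, and the coefficients of all others have
order \<open>p + 1\<close>.\<close>

lemma order_conditions:
  assumes x: "x \<in> \<Omega>" "x' \<in> \<Omega>" and eq: "\<And>\<tau>. vertices \<tau> \<le> p \<Longrightarrow> w x \<tau> = w x' \<tau>"
  shows "\<exists>C. \<forall>\<theta>\<in>\<Theta>. norm (V \<theta> x - V \<theta> x') \<le> C * norm (z \<theta>) ^ Suc p"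
proof -
  have "\<exists>C. \<forall>\<theta>\<in>\<Theta>. \<bar>(V \<theta> x - V \<theta> x') \<bullet> j\<bar> \<le> C * norm (z \<theta>) ^ Suc p" if j: "j \<in> Basis" for j
  proof -
    obtain cs C where cs: "graded 1 cs" and C: "\<And>\<theta> x. \<theta> \<in> \<Theta> \<Longrightarrow> x \<in> \<Omega> \<Longrightarrow>
        \<bar>(V \<theta> x - y \<theta>) \<bullet> j - tree_sum cs \<theta> x\<bar> \<le> C * norm (z \<theta>) ^ Suc p"
    proof -
      obtain cs where cs: "graded 1 cs" "of_order (Suc p) (\<lambda>\<theta> x. (V \<theta> x - y \<theta>) \<bullet> j - tree_sum cs \<theta> x)"
        using stage_expansion[OF field_expansion[OF order_refl] j] by blast
      from cs(2) show thesis by (rule orderE) (use that[OF cs(1)] in blast)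
    qed
    have "\<exists>D. \<forall>\<theta>\<in>\<Theta>. \<bar>tree_sum cs \<theta> x - tree_sum cs \<theta> x'\<bar> \<le> D * norm (z \<theta>) ^ Suc p"
      using cs
    proof (induction cs)
      case Nil
      show ?case by (rule exI[of _ 0]) simp
    next
      case (Cons t cs)
      obtain c ts where t: "t = (c, ts)" by (cases t)
      let ?d = "w x (Node undefined ts) - w x' (Node undefined ts)"
      obtain D where D: "\<And>\<theta>. \<theta> \<in> \<Theta> \<Longrightarrow> \<bar>tree_sum cs \<theta> x - tree_sum cs \<theta> x'\<bar> \<le> D * norm (z \<theta>) ^ Suc p"
        using Cons by (auto simp: t)
      have "\<exists>E. \<forall>\<theta>\<in>\<Theta>. \<bar>c \<theta> * ?d\<bar> \<le> E * norm (z \<theta>) ^ Suc p"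
      proof (cases "Suc (forest_size ts) \<le> p")
        case True
        then have "?d = 0" using eq[of "Node undefined ts"] by (simp add: vertices_Node del: vertices.simps)
        then show ?thesis by (intro exI[of _ 0]) simp
      next
        case False
        have "of_order (forest_size ts + 1) (\<lambda>\<theta> x. c \<theta>)"
          using Cons.prems by (simp add: t)
        then have "of_order (Suc p) (\<lambda>\<theta> x. c \<theta>)"
          by (rule order_weaken) (use False in simp)
        then obtain E where E: "0 \<le> E" "\<And>\<theta> x. \<theta> \<in> \<Theta> \<Longrightarrow> x \<in> \<Omega> \<Longrightarrow> \<bar>c \<theta>\<bar> \<le> E * norm (z \<theta>) ^ Suc p"
          by (rule orderE) blast
        show ?thesis
          by (rule exI[of _ "E * \<bar>?d\<bar>"])
             (use mult_right_mono[OF E(2)[OF _ x(1)], of _ "\<bar>?d\<bar>"] in \<open>auto simp: abs_mult mult_ac\<close>)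
      qed
      then obtain E where E: "\<And>\<theta>. \<theta> \<in> \<Theta> \<Longrightarrow> \<bar>c \<theta> * ?d\<bar> \<le> E * norm (z \<theta>) ^ Suc p" by blast
      have "\<bar>tree_sum (t # cs) \<theta> x - tree_sum (t # cs) \<theta> x'\<bar> \<le> (E + D) * norm (z \<theta>) ^ Suc p"
        if "\<theta> \<in> \<Theta>" for \<theta>
      proof -
        have "tree_sum (t # cs) \<theta> x - tree_sum (t # cs) \<theta> x'
            = c \<theta> * ?d + (tree_sum cs \<theta> x - tree_sum cs \<theta> x')" by (simp add: t algebra_simps)
        then show ?thesis
          unfolding distrib_right using D[OF that] E[OF that] by linarith
      qed
      then show ?case by blast
    qed
    then obtain D where D: "\<And>\<theta>. \<theta> \<in> \<Theta> \<Longrightarrow> \<bar>tree_sum cs \<theta> x - tree_sum cs \<theta> x'\<bar> \<le> D * norm (z \<theta>) ^ Suc p"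
      by blast
    have "\<bar>(V \<theta> x - V \<theta> x') \<bullet> j\<bar> \<le> (C + C + D) * norm (z \<theta>) ^ Suc p" if "\<theta> \<in> \<Theta>" for \<theta>
      using C[OF that x(1)] C[OF that x(2)] D[OF that]
      unfolding distrib_right inner_diff_left by linarith
    then show ?thesis by blast
  qed
  then obtain C where C: "\<And>j \<theta>. j \<in> Basis \<Longrightarrow> \<theta> \<in> \<Theta> \<Longrightarrow>
      \<bar>(V \<theta> x - V \<theta> x') \<bullet> j\<bar> \<le> C j * norm (z \<theta>) ^ Suc p"
    by metis
  show ?thesis
  proof (intro exI[of _ "\<Sum>j\<in>Basis. C j"] ballI)
    fix \<theta> assume *: "\<theta> \<in> \<Theta>"
    have "norm (V \<theta> x - V \<theta> x') \<le> (\<Sum>j\<in>Basis. \<bar>(V \<theta> x - V \<theta> x') \<bullet> j\<bar>)" by (rule norm_le_l1)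
    also have "\<dots> \<le> (\<Sum>j\<in>Basis. C j * norm (z \<theta>) ^ Suc p)" using C * by (intro sum_mono) auto
    finally show "norm (V \<theta> x - V \<theta> x') \<le> (\<Sum>j\<in>Basis. C j) * norm (z \<theta>) ^ Suc p"
      by (simp add: sum_distrib_right)
  qed
qed

end

section \<open>The local error of a Runge-Kutta method of tree order p\<close>

text \<open>The three kinds of nodes: \<open>Inl t\<close> is the exact solution at time \<open>t\<close>, with the weight \<open>t\<^sup>|\<^sup>\<tau>\<^sup>| / \<gamma>(\<tau>)\<close> of the
exact B-series, \<open>Inr (Some i)\<close> is the \<open>i\<close>-th stage and \<open>Inr None\<close> the output of the method.\<close>

fun rk_weight :: "real^'q^'q \<Rightarrow> real^'q \<Rightarrow> real + 'q option \<Rightarrow> 'm rtree \<Rightarrow> real" where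
  "rk_weight A b (Inl t) \<tau> = t ^ vertices \<tau> / real (fact_rtree \<tau>)"
| "rk_weight A b (Inr (Some i)) \<tau> = stage_weight A \<tau> $ i"
| "rk_weight A b (Inr None) \<tau> = step_weight A b \<tau>"

definition rk_nodes :: "(real + 'q option) set" where
  "rk_nodes = Inl ` {0..1} \<union> range Inr"

text \<open>The parameter collects the data of one step, whose length is normalised to \<open>1\<close>: the increment \<open>z\<close> of the
driver, the initial value \<open>y\<close>, the exact curve \<open>U\<close> and the stages \<open>Y\<close>.\<close>

fun rk_curve :: "('m::finite \<Rightarrow> real^'e \<Rightarrow> real^'e) \<Rightarrow> real^'q
     \<Rightarrow> (real^'m) \<times> (real^'e) \<times> (real \<Rightarrow> real^'e) \<times> ('q \<Rightarrow> real^'e) \<Rightarrow> real + 'q option \<Rightarrow> real^'e" where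
  "rk_curve F b (z, y, U, Y) (Inl t) = U t"
| "rk_curve F b (z, y, U, Y) (Inr (Some i)) = Y i"
| "rk_curve F b (z, y, U, Y) (Inr None) = y + (\<Sum>a\<in>UNIV. \<Sum>i\<in>UNIV. (b $ i * z $ a) *\<^sub>R F a (Y i))"

lemma fact_rtree_pos: "fact_rtree \<tau> > 0"
proof (induction \<tau>)
  case (Node a ts)
  then have "prod_mset (image_mset fact_rtree ts) > 0"
    by (induction ts) auto
  then show ?case by simp
qed

lemma prod_mset_exact_weight:
  "prod_mset (image_mset (rk_weight A b (Inl t)) ts)
     = t ^ forest_size ts / real (prod_mset (image_mset fact_rtree ts))"
  by (induction ts) (simp_all add: forest_size_def power_add)

lemma prod_mset_nth: "(prod_mset (image_mset f ts) :: real^'q) $ i = prod_mset (image_mset (\<lambda>\<tau>. f \<tau> $ i) ts)"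
  by (induction ts) simp_all

lemma rk_weight_stage: "rk_weight A b (Inr (Some i)) = (\<lambda>\<tau>. stage_weight A \<tau> $ i)"
  by (rule ext) simp

lemma rk_nodes_cases:
  assumes "x \<in> rk_nodes"
  obtains (curve) t where "x = Inl t" "t \<in> {0..1}"
    | (stage) i where "x = Inr (Some i)" | (result) "x = Inr None"
proof (cases x)
  case (Inl t)
  then show thesis using assms that(1) by (auto simp: rk_nodes_def)
next
  case (Inr o')
  then show thesis using that(2,3) by (cases o') auto
qed

lemma step_weight_Node: "step_weight A b (Node a ts) = (\<Sum>i\<in>UNIV. b $ i * prod_mset (image_mset (rk_weight A b (Inr (Some i))) ts))"
  by (simp add: inner_vec_def prod_mset_nth rk_weight_stage)

lemma stage_weight_Node: "stage_weight A (Node a ts) $ i = (\<Sum>j\<in>UNIV. A $ i $ j * prod_mset (image_mset (rk_weight A b (Inr (Some j))) ts))"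
  by (simp add: matrix_vector_mult_def prod_mset_nth rk_weight_stage)

text \<open>The tree factorial is made for this: dividing by the number of vertices is integrating the monomial.\<close>

lemma exact_weight_deriv:
  "((\<lambda>t. rk_weight A b (Inl t) (Node a ts)) has_real_derivative
      prod_mset (image_mset (rk_weight A b (Inl t)) ts)) (at t)"
proof -
  let ?n = "forest_size ts" and ?f = "real (prod_mset (image_mset fact_rtree ts))"
  have eq: "(\<lambda>t. rk_weight A b (Inl t) (Node a ts)) = (\<lambda>t. t ^ Suc ?n / (real (Suc ?n) * ?f))"
    by (simp only: rk_weight.simps fact_rtree.simps vertices_Node of_nat_mult)
  have "((\<lambda>t. t ^ Suc ?n / (real (Suc ?n) * ?f)) has_real_derivative
      real (Suc ?n) * t ^ (Suc ?n - Suc 0) / (real (Suc ?n) * ?f)) (at t)"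
    by (intro DERIV_cdivide DERIV_pow)
  also have "real (Suc ?n) * t ^ (Suc ?n - Suc 0) / (real (Suc ?n) * ?f) = t ^ ?n / ?f"
    by (simp del: of_nat_Suc)
  finally show ?thesis unfolding eq prod_mset_exact_weight .
qed

text \<open>Averaging for the exact solution is integration from \<open>0\<close> to \<open>t \<le> 1\<close>. Comparing derivatives by the mean
value theorem avoids the integral.\<close>

lemma exact_stage_bound:
  fixes U :: "real \<Rightarrow> real^'e" and F :: "'m::finite \<Rightarrow> real^'e \<Rightarrow> real^'e"
  assumes cont: "continuous_on {0..1} U"
    and ode: "\<And>t. t \<in> {0<..<1} \<Longrightarrow> (U has_vector_derivative (\<Sum>a\<in>UNIV. z $ a *\<^sub>R F a (U t))) (at t)"
    and bound: "\<And>t. t \<in> {0..1} \<Longrightarrow> \<bar>(\<Sum>a\<in>UNIV. z $ a * (F a (U t) \<bullet> j))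
        - (\<Sum>(c, ts)\<leftarrow>cs. c * prod_mset (image_mset (rk_weight A b (Inl t)) ts))\<bar> \<le> \<delta>"
    and t: "t \<in> {0..1}"
  shows "\<bar>(U t - U 0) \<bullet> j - (\<Sum>(c, ts)\<leftarrow>cs. c * rk_weight A b (Inl t) (Node a ts))\<bar> \<le> \<delta>"
proof (cases "t = 0")
  case True
  have "(\<Sum>(c, ts)\<leftarrow>cs. c * rk_weight A b (Inl 0) (Node a ts)) = 0"
    by (induction cs) auto
  then show ?thesis using bound[of 0] True by simp
next
  case False
  then have t0: "0 < t" "t \<le> 1" using t by auto
  let ?P = "\<lambda>t. \<Sum>(c, ts)\<leftarrow>cs. c * rk_weight A b (Inl t) (Node a ts)"
  let ?Q = "\<lambda>t. \<Sum>(c, ts)\<leftarrow>cs. c * prod_mset (image_mset (rk_weight A b (Inl t)) ts)"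
  have P: "(?P has_real_derivative ?Q t) (at t)" for t
  proof (induction cs)
    case (Cons u cs)
    obtain c ts where u: "u = (c, ts)" by (cases u)
    show ?case
      unfolding u list.map sum_list.Cons prod.case
      by (intro DERIV_add Cons.IH DERIV_cmult exact_weight_deriv)
  qed simp
  let ?h = "\<lambda>t. (U t - U 0) \<bullet> j - ?P t"
  have cont_h: "continuous_on {0..t} ?h"
  proof -
    have "continuous_on {0..t} ?P"
      by (intro continuous_at_imp_continuous_on ballI DERIV_isCont[OF P])
    moreover have "continuous_on {0..t} U" by (rule continuous_on_subset[OF cont]) (use t0 in auto)
    ultimately show ?thesis by (intro continuous_intros)
  qed
  have deriv: "(?h has_real_derivative (\<Sum>a\<in>UNIV. z $ a * (F a (U s) \<bullet> j)) - ?Q s) (at s)"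
    if "0 < s" "s < t" for s
  proof -
    have "((\<lambda>s. (U s - U 0) \<bullet> j) has_vector_derivative (\<Sum>a\<in>UNIV. z $ a *\<^sub>R F a (U s)) \<bullet> j) (at s)"
      using bounded_linear.has_vector_derivative[OF bounded_linear_inner_left[of j]
          has_vector_derivative_diff[OF ode[of s] has_vector_derivative_const[of "U 0"]]] that t0
      by simp
    then have "((\<lambda>s. (U s - U 0) \<bullet> j) has_real_derivative (\<Sum>a\<in>UNIV. z $ a * (F a (U s) \<bullet> j))) (at s)"
      by (simp add: has_real_derivative_iff_has_vector_derivative inner_sum_left)
    from DERIV_diff[OF this P] show ?thesis .
  qed
  have "\<exists>l s. 0 < s \<and> s < t \<and> DERIV ?h s :> l \<and> ?h t - ?h 0 = (t - 0) * l"
    by (rule MVT[OF t0(1) cont_h]) (unfold real_differentiable_def, rule exI, rule deriv)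
  then obtain l s where s: "0 < s" "s < t" "DERIV ?h s :> l" "?h t - ?h 0 = (t - 0) * l"
    by blast
  have l: "l = (\<Sum>a\<in>UNIV. z $ a * (F a (U s) \<bullet> j)) - ?Q s"
    using DERIV_unique[OF s(3) deriv[OF s(1,2)]] .
  have "?h 0 = 0"
    by (induction cs) auto
  then have "\<bar>?h t\<bar> = t * \<bar>l\<bar>" using s t0 by (simp add: abs_mult)
  also have "\<dots> \<le> 1 * \<delta>"
    using bound[of s] s t0 unfolding l by (intro mult_mono) auto
  finally show ?thesis by simp
qed

lemma weighted_stage_bound:
  fixes k :: "'q::finite \<Rightarrow> real" and w :: "'q \<Rightarrow> 'm rtree multiset \<Rightarrow> real"
  assumes "\<And>i. \<bar>W i - (\<Sum>(c, ts)\<leftarrow>cs. c * w i ts)\<bar> \<le> \<delta>"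
  shows "\<bar>(\<Sum>i\<in>UNIV. k i * W i) - (\<Sum>(c, ts)\<leftarrow>cs. c * (\<Sum>i\<in>UNIV. k i * w i ts))\<bar> \<le> (\<Sum>i\<in>UNIV. \<bar>k i\<bar>) * \<delta>"
proof -
  have "(\<Sum>(c, ts)\<leftarrow>cs. c * (\<Sum>i\<in>UNIV. k i * w i ts)) = (\<Sum>i\<in>UNIV. k i * (\<Sum>(c, ts)\<leftarrow>cs. c * w i ts))"
    by (induction cs) (auto simp: sum.distrib sum_distrib_left algebra_simps)
  then have "(\<Sum>i\<in>UNIV. k i * W i) - (\<Sum>(c, ts)\<leftarrow>cs. c * (\<Sum>i\<in>UNIV. k i * w i ts))
      = (\<Sum>i\<in>UNIV. k i * (W i - (\<Sum>(c, ts)\<leftarrow>cs. c * w i ts)))"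
    by (simp add: sum_subtractf algebra_simps)
  also have "\<bar>\<dots>\<bar> \<le> (\<Sum>i\<in>UNIV. \<bar>k i\<bar> * \<delta>)"
    using assms by (intro order.trans[OF sum_abs] sum_mono) (auto simp: abs_mult intro: mult_left_mono)
  finally show ?thesis by (simp add: sum_distrib_right)
qed

text \<open>The exact curve, the stages and the output form one Runge-Kutta family, and tree order \<open>p\<close> says exactly
that the weights of small trees at the end point of the curve and at the output agree. The stages
enter as members of the family, so any solution of an implicit stage system will do. The constant depends on the step only through the bound \<open>M\<close> on the increment.\<close>

lemma scrk_local_error:
  fixes A :: "real^'q^'q" and b :: "real^'q" and F :: "'m::finite \<Rightarrow> real^'e \<Rightarrow> real^'e"
  assumes F: "\<And>a. Cb p (F a)"
    and tree_order: "\<And>\<tau> :: 'm rtree. vertices \<tau> \<le> p \<Longrightarrow> step_weight A b \<tau> = 1 / real (fact_rtree \<tau>)"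
  shows "\<exists>C\<ge>0. \<forall>z U Y. norm z \<le> M \<longrightarrow> continuous_on {0..1} U \<longrightarrow>
      (\<forall>t\<in>{0<..<1}. (U has_vector_derivative (\<Sum>a\<in>UNIV. z $ a *\<^sub>R F a (U t))) (at t)) \<longrightarrow>
      (\<forall>i. Y i = U 0 + (\<Sum>a\<in>UNIV. \<Sum>j\<in>UNIV. (A $ i $ j * z $ a) *\<^sub>R F a (Y j))) \<longrightarrow>
      norm (U 1 - (U 0 + (\<Sum>a\<in>UNIV. \<Sum>i\<in>UNIV. (b $ i * z $ a) *\<^sub>R F a (Y i)))) \<le> C * norm z ^ Suc p"
proof -
  \<comment> \<open>A name for the implicit equation, which would rewrite \<open>Y i\<close> forever if used as a simplification rule.\<close>
  define stage_system where "stage_system z y Y \<longleftrightarrow>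
      (\<forall>i. Y i = y + (\<Sum>a\<in>UNIV. \<Sum>j\<in>UNIV. (A $ i $ j * z $ a) *\<^sub>R F a (Y j)))" for z y Y
  define \<Theta> :: "((real^'m) \<times> (real^'e) \<times> (real \<Rightarrow> real^'e) \<times> ('q \<Rightarrow> real^'e)) set" where
    "\<Theta> = {(z, y, U, Y). norm z \<le> M \<and> continuous_on {0..1} U \<and> U 0 = y \<and>
      (\<forall>t\<in>{0<..<1}. (U has_vector_derivative (\<Sum>a\<in>UNIV. z $ a *\<^sub>R F a (U t))) (at t)) \<and>
      stage_system z y Y}"
  \<comment> \<open>\<open>1\<close> bounds the integration, the row sums of the tableau bound the stages and the output.\<close>
  define K where "K = 1 + (\<Sum>i\<in>UNIV. \<Sum>j\<in>UNIV. \<bar>A $ i $ j\<bar>) + (\<Sum>i\<in>UNIV. \<bar>b $ i\<bar>)"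
  let ?w = "rk_weight A b :: real + 'q option \<Rightarrow> 'm rtree \<Rightarrow> real"
  interpret weighted_forests \<Theta> rk_nodes "\<lambda>\<theta>. norm (fst \<theta>)" M ?w
  proof
    fix \<tau> :: "'m rtree"
    have "\<bar>?w x \<tau>\<bar> \<le> 1 + (\<Sum>i\<in>UNIV. \<bar>stage_weight A \<tau> $ i\<bar>) + \<bar>step_weight A b \<tau>\<bar>" if "x \<in> rk_nodes" for x
      using that
    proof (cases rule: rk_nodes_cases)
      case (curve t)
      then have "\<bar>t\<bar> ^ vertices \<tau> \<le> 1" by (auto intro: power_le_one)
      then have "\<bar>t ^ vertices \<tau> / real (fact_rtree \<tau>)\<bar> \<le> 1"
        using fact_rtree_pos[of \<tau>] by (simp add: power_abs divide_le_eq)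
      moreover have "0 \<le> (\<Sum>i\<in>UNIV. \<bar>stage_weight A \<tau> $ i\<bar>)" by (intro sum_nonneg) auto
      ultimately show ?thesis unfolding curve rk_weight.simps by linarith
    next
      case (stage i)
      have "\<bar>stage_weight A \<tau> $ i\<bar> \<le> (\<Sum>i\<in>UNIV. \<bar>stage_weight A \<tau> $ i\<bar>)"
        by (intro member_le_sum) auto
      then show ?thesis unfolding stage rk_weight.simps by linarith
    next
      case result
      have "0 \<le> (\<Sum>i\<in>UNIV. \<bar>stage_weight A \<tau> $ i\<bar>)" by (intro sum_nonneg) auto
      then show ?thesis unfolding result rk_weight.simps by linarith
    qed
    then show "\<exists>C. \<forall>x\<in>rk_nodes. \<bar>?w x \<tau>\<bar> \<le> C" by blast
  qed (auto simp: \<Theta>_def rk_nodes_def)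
  interpret runge_kutta_family \<Theta> rk_nodes fst M ?w F "\<lambda>\<theta>. fst (snd \<theta>)" "rk_curve F b" p K
  proof
    fix a show "Cb p (F a)" by (rule F)
  next
    fix \<theta> j cs \<delta> x
    assume \<theta>: "\<theta> \<in> \<Theta>" and j: "j \<in> (Basis :: (real^'e) set)" and x: "x \<in> (rk_nodes :: (real + 'q option) set)"
      and bound: "\<And>x :: real + 'q option. x \<in> rk_nodes \<Longrightarrow>
        \<bar>(\<Sum>a\<in>UNIV. fst \<theta> $ a * (F a (rk_curve F b \<theta> x) \<bullet> j)) - forest_sum cs \<theta> x\<bar> \<le> \<delta>"
    obtain z y U Y where \<theta>_eq: "\<theta> = (z, y, U, Y)" by (cases \<theta>)
    have exact: "continuous_on {0..1} U" "U 0 = y"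
        "\<And>t. t \<in> {0<..<1} \<Longrightarrow> (U has_vector_derivative (\<Sum>a\<in>UNIV. z $ a *\<^sub>R F a (U t))) (at t)"
      and sys: "stage_system z y Y"
      using \<theta> by (simp_all add: \<theta>_eq \<Theta>_def)
    note stage_eq = sys[unfolded stage_system_def, THEN spec]
    let ?cs = "map (\<lambda>(c, ts). (c \<theta>, ts)) cs"
    have fsum: "forest_sum cs \<theta> x = (\<Sum>(c, ts)\<leftarrow>?cs. c * prod_mset (image_mset (?w x) ts))" for x
      unfolding forest_sum_def forest_weight_def by (induction cs) auto
    have tsum: "tree_sum cs \<theta> x = (\<Sum>(c, ts)\<leftarrow>?cs. c * ?w x (Node undefined ts))" for x
      unfolding tree_sum_def by (induction cs) auto
    have \<delta>: "0 \<le> \<delta>"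
      using order.trans[OF abs_ge_zero bound[of "Inl 0"]] by (simp add: rk_nodes_def)
    have stages: "\<bar>(\<Sum>a\<in>UNIV. z $ a * (F a (Y i) \<bullet> j))
        - (\<Sum>(c, ts)\<leftarrow>?cs. c * prod_mset (image_mset (?w (Inr (Some i))) ts))\<bar> \<le> \<delta>" for i
      using bound[of "Inr (Some i)"] unfolding fsum by (simp add: \<theta>_eq rk_nodes_def)
    have comb: "(\<Sum>a\<in>UNIV. \<Sum>i\<in>UNIV. (k i * z $ a) *\<^sub>R F a (Y i)) \<bullet> j
        = (\<Sum>i\<in>UNIV. k i * (\<Sum>a\<in>UNIV. z $ a * (F a (Y i) \<bullet> j)))" for k :: "'q \<Rightarrow> real"
      by (simp add: inner_sum_left sum_distrib_left mult.assoc) (rule sum.swap)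
    have combo: "\<bar>(\<Sum>i\<in>UNIV. k i * (\<Sum>a\<in>UNIV. z $ a * (F a (Y i) \<bullet> j)))
        - (\<Sum>(c, ts)\<leftarrow>?cs. c * (\<Sum>i\<in>UNIV. k i * prod_mset (image_mset (?w (Inr (Some i))) ts)))\<bar>
        \<le> (\<Sum>i\<in>UNIV. \<bar>k i\<bar>) * \<delta>" for k
      by (rule weighted_stage_bound[OF stages])
    have nonneg: "0 \<le> (\<Sum>i\<in>UNIV. \<Sum>j\<in>UNIV. \<bar>A $ i $ j\<bar>)" "0 \<le> (\<Sum>i\<in>UNIV. \<bar>b $ i\<bar>)"
      by (simp_all add: sum_nonneg)
    show "\<bar>(rk_curve F b \<theta> x - fst (snd \<theta>)) \<bullet> j - tree_sum cs \<theta> x\<bar> \<le> K * \<delta>"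
      using x
    proof (cases rule: rk_nodes_cases)
      case (curve t)
      have "\<bar>(U t - U 0) \<bullet> j - tree_sum cs \<theta> x\<bar> \<le> \<delta>"
        unfolding tsum curve(1)
      proof (intro exact_stage_bound[where z = z and F = F, OF _ _ _ curve(2)])
        fix t :: real assume "t \<in> {0..1}"
        then show "\<bar>(\<Sum>a\<in>UNIV. z $ a * (F a (U t) \<bullet> j))
          - (\<Sum>(c, ts)\<leftarrow>?cs. c * prod_mset (image_mset (rk_weight A b (Inl t)) ts))\<bar> \<le> \<delta>"
          using bound[of "Inl t"] unfolding fsum by (simp add: \<theta>_eq rk_nodes_def)
      qed (use exact in auto)
      also have "\<delta> \<le> K * \<delta>"
        using mult_right_mono[of 1 K \<delta>] \<delta> nonneg by (simp add: K_def)
      finally show ?thesis using curve exact(2) by (simp add: \<theta>_eq)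
    next
      case (stage i)
      have "Y i - y = (\<Sum>a\<in>UNIV. \<Sum>j\<in>UNIV. (A $ i $ j * z $ a) *\<^sub>R F a (Y j))"
        by (subst stage_eq) simp
      then have "\<bar>(Y i - y) \<bullet> j - tree_sum cs \<theta> x\<bar> \<le> (\<Sum>k\<in>UNIV. \<bar>A $ i $ k\<bar>) * \<delta>"
        using combo[of "\<lambda>k. A $ i $ k"]
        unfolding tsum stage by (simp only: comb rk_weight.simps stage_weight_Node[where b = b])
      also have "\<dots> \<le> K * \<delta>"
      proof -
        have "(\<Sum>k\<in>UNIV. \<bar>A $ i $ k\<bar>) \<le> (\<Sum>i\<in>UNIV. \<Sum>k\<in>UNIV. \<bar>A $ i $ k\<bar>)"
          by (rule member_le_sum[of i UNIV "\<lambda>i. \<Sum>k\<in>UNIV. \<bar>A $ i $ k\<bar>"]) (auto intro: sum_nonneg)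
        then have "(\<Sum>k\<in>UNIV. \<bar>A $ i $ k\<bar>) \<le> K" using nonneg unfolding K_def by linarith
        then show ?thesis using \<delta> by (rule mult_right_mono)
      qed
      finally show ?thesis using stage by (simp add: \<theta>_eq)
    next
      case result
      have "\<bar>(rk_curve F b \<theta> x - y) \<bullet> j - tree_sum cs \<theta> x\<bar> \<le> (\<Sum>k\<in>UNIV. \<bar>b $ k\<bar>) * \<delta>"
        using combo[of "\<lambda>k. b $ k"]
        unfolding tsum unfolding result \<theta>_eq rk_curve.simps
        by (simp only: add_diff_cancel_left' comb rk_weight.simps step_weight_Node)
      also have "\<dots> \<le> K * \<delta>"
      proof (rule mult_right_mono[OF _ \<delta>])
        show "(\<Sum>k\<in>UNIV. \<bar>b $ k\<bar>) \<le> K" using nonneg unfolding K_def by linarith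
      qed
      finally show ?thesis by (simp add: \<theta>_eq)
    qed
  qed
  obtain C where C: "\<And>\<theta>. \<theta> \<in> \<Theta> \<Longrightarrow>
      norm (rk_curve F b \<theta> (Inl 1) - rk_curve F b \<theta> (Inr None)) \<le> C * norm (fst \<theta>) ^ Suc p"
  proof -
    have "?w (Inl 1) \<tau> = ?w (Inr None) \<tau>" if "vertices \<tau> \<le> p" for \<tau>
      using tree_order[OF that] by simp
    then show thesis
      using order_conditions[of "Inl 1" "Inr None"] that by (auto simp: rk_nodes_def)
  qed
  show ?thesis
  proof (intro exI[of _ "\<bar>C\<bar>"] conjI allI impI)
    fix z U Y
    assume "norm z \<le> M" "continuous_on {0..1} U"
      "\<forall>t\<in>{0<..<1}. (U has_vector_derivative (\<Sum>a\<in>UNIV. z $ a *\<^sub>R F a (U t))) (at t)"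
      "\<forall>i. Y i = U 0 + (\<Sum>a\<in>UNIV. \<Sum>j\<in>UNIV. (A $ i $ j * z $ a) *\<^sub>R F a (Y j))"
    then have "(z, U 0, U, Y) \<in> \<Theta>" unfolding \<Theta>_def stage_system_def by blast
    from C[OF this]
    have "norm (U 1 - (U 0 + (\<Sum>a\<in>UNIV. \<Sum>i\<in>UNIV. (b $ i * z $ a) *\<^sub>R F a (Y i)))) \<le> C * norm z ^ Suc p"
      by simp
    also have "\<dots> \<le> \<bar>C\<bar> * norm z ^ Suc p" by (simp add: mult_right_mono del: power_Suc)
    finally show "norm (U 1 - (U 0 + (\<Sum>a\<in>UNIV. \<Sum>i\<in>UNIV. (b $ i * z $ a) *\<^sub>R F a (Y i)))) \<le> \<bar>C\<bar> * norm z ^ Suc p" .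
  qed simp
qed

section \<open>Lipschitz differential equations\<close>

text \<open>Gronwall's argument: \<open>e\<^sup>-\<^sup>2\<^sup>K\<^sup>r |u(r) - v(r)|\<^sup>2\<close> is nonincreasing and vanishes at \<open>s\<close>. The equation is only
assumed in the open interval, as the solutions used later have kinks at the partition points.\<close>

lemma lipschitz_ode_unique:
  fixes u v :: "real \<Rightarrow> 'a::real_inner"
  assumes lip: "\<And>x y. norm (g x - g y) \<le> K * norm (x - y)"
    and cont: "continuous_on {s..t} u" "continuous_on {s..t} v"
    and u: "\<And>r. s < r \<Longrightarrow> r < t \<Longrightarrow> (u has_vector_derivative g (u r)) (at r)"
    and v: "\<And>r. s < r \<Longrightarrow> r < t \<Longrightarrow> (v has_vector_derivative g (v r)) (at r)"
    and init: "u s = v s" and r: "r \<in> {s..t}"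
  shows "u r = v r"
proof (cases "s = r")
  case False
  then have sr: "s < r" "r \<le> t" using r by auto
  let ?w = "\<lambda>r. u r - v r"
  let ?h = "\<lambda>r. exp (- (2 * K * r)) * (?w r \<bullet> ?w r)"
  have "?h r \<le> ?h s"
  proof (rule DERIV_nonpos_imp_decreasing_open[OF less_imp_le[OF sr(1)]])
    fix x assume x: "s < x" "x < r"
    have w: "(?w has_derivative (\<lambda>h. h *\<^sub>R (g (u x) - g (v x)))) (at x)"
      using has_vector_derivative_diff[OF u[of x] v[of x]] x sr by (simp add: has_vector_derivative_def)
    have "((\<lambda>r. ?w r \<bullet> ?w r) has_derivative
        (\<lambda>h. ?w x \<bullet> (h *\<^sub>R (g (u x) - g (v x))) + (h *\<^sub>R (g (u x) - g (v x))) \<bullet> ?w x)) (at x)"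
      by (rule has_derivative_inner[OF w w])
    then have sq: "((\<lambda>r. ?w r \<bullet> ?w r) has_real_derivative 2 * (?w x \<bullet> (g (u x) - g (v x)))) (at x)"
      by (rule has_derivative_imp_has_field_derivative) (simp add: inner_commute)
    have "((\<lambda>r. exp (- (2 * K * r))) has_real_derivative exp (- (2 * K * x)) * (- (2 * K))) (at x)"
      by (auto intro!: derivative_eq_intros)
    from DERIV_mult[OF this sq]
    have "(?h has_real_derivative
        exp (- (2 * K * x)) * (2 * (?w x \<bullet> (g (u x) - g (v x))) - 2 * K * (?w x \<bullet> ?w x))) (at x)"
      by (simp add: algebra_simps)
    moreover have "?w x \<bullet> (g (u x) - g (v x)) \<le> K * (?w x \<bullet> ?w x)"
    proof -
      have "?w x \<bullet> (g (u x) - g (v x)) \<le> norm (?w x) * norm (g (u x) - g (v x))" by (rule norm_cauchy_schwarz)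
      also have "\<dots> \<le> norm (?w x) * (K * norm (?w x))" by (intro mult_left_mono lip) simp
      finally show ?thesis by (simp add: dot_square_norm power2_eq_square algebra_simps)
    qed
    then have "exp (- (2 * K * x)) * (2 * (?w x \<bullet> (g (u x) - g (v x))) - 2 * K * (?w x \<bullet> ?w x)) \<le> 0"
      by (intro mult_nonneg_nonpos) auto
    ultimately show "\<exists>D. (?h has_real_derivative D) (at x) \<and> D \<le> 0" by blast
  next
    have "continuous_on {s..r} u" "continuous_on {s..r} v"
      using cont sr by (auto elim: continuous_on_subset)
    then show "continuous_on {s..r} ?h" by (intro continuous_intros)
  qed
  then have "exp (- (2 * K * r)) * (?w r \<bullet> ?w r) \<le> 0" using init by simp
  then have "?w r \<bullet> ?w r \<le> 0" by (simp add: mult_le_0_iff)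
  then have "?w r \<bullet> ?w r = 0" using inner_ge_zero[of "?w r"] by linarith
  then show ?thesis by simp
qed (use init in simp)

text \<open>Picard iteration. The differences of consecutive iterates, measured against the weight \<open>e\<^sup>2\<^sup>K\<^sup>t\<close>, are halved
in each step, so the iteration converges on the whole unit interval however large \<open>K\<close> is.\<close>

lemma lipschitz_ode_exists:
  fixes g :: "'a::euclidean_space \<Rightarrow> 'a"
  assumes K: "0 < K" and lip: "\<And>x y. norm (g x - g y) \<le> K * norm (x - y)"
  obtains u where "continuous_on {0..1} u" "u 0 = x"
    "\<And>t. t \<in> {0<..<1} \<Longrightarrow> (u has_vector_derivative g (u t)) (at t)"
proof -
  define iter :: "nat \<Rightarrow> real \<Rightarrow> 'a" where "iter = rec_nat (\<lambda>t. x) (\<lambda>_ w t. x + integral {0..t} (\<lambda>s. g (w s)))"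
  have iter_0: "iter 0 t = x" and iter_Suc: "iter (Suc n) t = x + integral {0..t} (\<lambda>s. g (iter n s))" for n t
    by (simp_all add: iter_def)
  have g_cont: "continuous_on S g" for S
  proof -
    have "K-lipschitz_on UNIV g"
      using lip K by (intro lipschitz_onI) (auto simp: dist_norm)
    then show ?thesis using lipschitz_on_continuous_on continuous_on_subset by blast
  qed
  have prim: "((\<lambda>t. x + integral {0..t} (\<lambda>s. g (w s))) has_vector_derivative g (w t)) (at t within {0..1})"
    if "continuous_on {0..1} w" "t \<in> {0..1}" for w t
  proof -
    have "continuous_on {0..1} (\<lambda>s. g (w s))"
      by (rule continuous_on_compose2[OF g_cont[of UNIV] that(1)]) auto
    from has_vector_derivative_add[OF has_vector_derivative_const integral_has_vector_derivative[OF this that(2)]]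
    show ?thesis by simp
  qed
  have cont: "continuous_on {0..1} (iter n)" for n
  proof (induction n)
    case 0
    then show ?case by (simp add: iter_0[abs_def] cong: continuous_on_cong)
  next
    case (Suc n)
    show ?case
      unfolding continuous_on_eq_continuous_within iter_Suc[abs_def]
      using has_vector_derivative_continuous[OF prim[OF Suc]] by blast
  qed
  have deriv: "(iter (Suc n) has_vector_derivative g (iter n t)) (at t within {0..1})" if "t \<in> {0..1}" for n t
    using prim[OF cont that, of n] by (simp add: iter_Suc[abs_def])
  have step: "norm (iter (Suc (Suc n)) t - iter (Suc n) t) \<le> c / 2 * exp (2 * K * t)"
    if c: "0 \<le> c" "\<And>t. t \<in> {0..1} \<Longrightarrow> norm (iter (Suc n) t - iter n t) \<le> c * exp (2 * K * t)"
      and t: "t \<in> {0..1}" for n c t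
  proof (cases "t = 0")
    case True
    then show ?thesis using c(1) by (simp add: iter_Suc)
  next
    case False
    with t have t0: "0 < t" "t \<le> 1" by auto
    let ?f = "\<lambda>s. iter (Suc (Suc n)) s - iter (Suc n) s"
    have "norm (?f t - ?f 0) \<le> c / 2 * exp (2 * K * t) - c / 2 * exp (2 * K * 0)"
    proof (rule differentiable_bound_general[OF t0(1)])
      show "continuous_on {0..t} ?f"
        using t0 by (intro continuous_on_diff continuous_on_subset[OF cont]) auto
      show "continuous_on {0..t} (\<lambda>t. c / 2 * exp (2 * K * t))" by (intro continuous_intros)
      fix s assume s: "0 < s" "s < t"
      have "at s within {0..1} = at s" using s t0 by (intro at_within_interior) auto
      then show "(?f has_vector_derivative g (iter (Suc n) s) - g (iter n s)) (at s)"
        using has_vector_derivative_diff[OF deriv[of s "Suc n"] deriv[of s n]] s t0 by simp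
      show "((\<lambda>t. c / 2 * exp (2 * K * t)) has_vector_derivative K * (c * exp (2 * K * s))) (at s)"
        unfolding has_real_derivative_iff_has_vector_derivative[symmetric]
        by (auto intro!: derivative_eq_intros)
      show "norm (g (iter (Suc n) s) - g (iter n s)) \<le> K * (c * exp (2 * K * s))"
        using order.trans[OF lip mult_left_mono[OF c(2)[of s], of K]] s t0 K by simp
    qed
    moreover have "?f 0 = 0" by (simp add: iter_Suc)
    ultimately show ?thesis using c(1) by simp
  qed
  define c where "c = norm (g x)"
  have bound: "norm (iter (Suc n) t - iter n t) \<le> c * (1/2) ^ n * exp (2 * K * t)" if "t \<in> {0..1}" for n t
    using that
  proof (induction n arbitrary: t)
    case 0
    have "norm (iter 1 t - iter 0 t) = t * c"
      using 0 by (simp add: iter_Suc iter_0 c_def)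
    also have "\<dots> \<le> exp (2 * K * t) * c"
    proof (rule mult_right_mono)
      have "t \<le> 1" "0 \<le> 2 * K * t" using 0 K by auto
      then show "t \<le> exp (2 * K * t)" using one_le_exp_iff[of "2 * K * t"] by linarith
    qed (simp add: c_def)
    finally show ?case by (simp add: mult.commute)
  next
    case (Suc n)
    then show ?case using step[of "c * (1/2) ^ n" n t] by (simp add: c_def)
  qed
  define M where "M n = c * (1/2) ^ n * exp (2 * K)" for n
  have "uniform_limit {0..1} (\<lambda>n t. \<Sum>i<n. iter (Suc i) t - iter i t) (\<lambda>t. \<Sum>i. iter (Suc i) t - iter i t) sequentially"
  proof (rule Weierstrass_m_test)
    show "summable M" unfolding M_def by (intro summable_mult2 summable_mult summable_geometric) simp
    fix n and t :: real assume t: "t \<in> {0..1}"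
    have "c * (1/2) ^ n * exp (2 * K * t) \<le> M n"
      unfolding M_def using t K by (intro mult_left_mono) (auto simp: c_def)
    then show "norm (iter (Suc n) t - iter n t) \<le> M n" using bound[OF t, of n] by linarith
  qed
  moreover have "(\<Sum>i<n. iter (Suc i) t - iter i t) = iter n t - x" for n t
    using sum_lessThan_telescope[of "\<lambda>i. iter i t" n] by (simp add: iter_0)
  ultimately have "uniform_limit {0..1} (\<lambda>n t. iter n t - x) (\<lambda>t. \<Sum>i. iter (Suc i) t - iter i t) sequentially"
    by simp
  then have "uniform_limit {0..1} (\<lambda>n t. (iter n t - x) + x)
      (\<lambda>t. (\<Sum>i. iter (Suc i) t - iter i t) + x) sequentially"
    by (intro uniform_limit_intros)
  then obtain u where u: "uniform_limit {0..1} iter u sequentially"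
    by auto
  have u_cont: "continuous_on {0..1} u"
    by (rule uniform_limit_theorem[OF _ u]) (auto intro: cont always_eventually)
  have u_eq: "u t = x + integral {0..t} (\<lambda>s. g (u s))" if t: "t \<in> {0..1}" for t
  proof -
    have "uniform_limit {0..1} (\<lambda>n s. g (iter n s)) (\<lambda>s. g (u s)) sequentially"
    proof (rule uniform_limitI)
      fix e :: real assume "0 < e"
      then have "\<forall>\<^sub>F n in sequentially. \<forall>s\<in>{0..1}. dist (iter n s) (u s) < e / K"
        using uniform_limitD[OF u] K by simp
      then show "\<forall>\<^sub>F n in sequentially. \<forall>s\<in>{0..1}. dist (g (iter n s)) (g (u s)) < e"
      proof (rule eventually_mono, intro ballI)
        fix n and s :: real assume "\<forall>s\<in>{0..1}. dist (iter n s) (u s) < e / K" "s \<in> {0..1}"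
        then have "K * norm (iter n s - u s) < e" using K by (simp add: dist_norm field_simps)
        then show "dist (g (iter n s)) (g (u s)) < e"
          using lip[of "iter n s" "u s"] by (simp add: dist_norm)
      qed
    qed
    then have lim: "uniform_limit (cbox 0 t) (\<lambda>n s. g (iter n s)) (\<lambda>s. g (u s)) sequentially"
      by (rule uniform_limit_on_subset) (use t in auto)
    have cg: "continuous_on (cbox 0 t) (\<lambda>s. g (iter n s))" for n
      by (rule continuous_on_compose2[OF g_cont[of UNIV] continuous_on_subset[OF cont]]) (use t in auto)
    obtain I J where I: "\<And>n. ((\<lambda>s. g (iter n s)) has_integral I n) (cbox 0 t)"
      and J: "((\<lambda>s. g (u s)) has_integral J) (cbox 0 t)" and IJ: "I \<longlonglongrightarrow> J"
      using uniform_limit_integral_cbox[OF lim cg] by auto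
    have "(\<lambda>n. iter (Suc n) t) \<longlonglongrightarrow> x + J"
      using I[THEN integral_unique] tendsto_add[OF tendsto_const IJ, of x] by (simp add: iter_Suc)
    moreover have "(\<lambda>n. iter (Suc n) t) \<longlonglongrightarrow> u t"
      using LIMSEQ_Suc tendsto_uniform_limitI[OF u t] by blast
    ultimately show ?thesis
      using LIMSEQ_unique J[THEN integral_unique] by fastforce
  qed
  show thesis
  proof (rule that[OF u_cont])
    show "u 0 = x" using u_eq[of 0] by simp
    fix t :: real assume t: "t \<in> {0<..<1}"
    have "((\<lambda>t. x + integral {0..t} (\<lambda>s. g (u s))) has_vector_derivative g (u t)) (at t within {0..1})"
      by (rule prim[OF u_cont]) (use t in auto)
    then have "(u has_vector_derivative g (u t)) (at t within {0..1})"
      by (rule has_vector_derivative_transform[rotated 2]) (use t u_eq in auto)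
    moreover have "at t within {0..1} = at t" using t by (intro at_within_interior) auto
    ultimately show "(u has_vector_derivative g (u t)) (at t)" by simp
  qed
qed

section \<open>The flow of the interpolated equation\<close>

lemma partition_nth:
  assumes "is_partition s t P"
  shows "P ! 0 = s" "P ! steps P = t" "last P = P ! steps P" "sorted_wrt (<) P"
  using assms by (auto simp: is_partition_def steps_def hd_conv_nth last_conv_nth)

lemma partition_less:
  assumes "is_partition s t P" "i < j" "j \<le> steps P"
  shows "P ! i < P ! j"
  using assms sorted_wrt_nth_less[of "(<)" P i j] by (cases P) (auto simp: is_partition_def steps_def)

lemma partition_le:
  assumes "is_partition s t P" "i \<le> j" "j \<le> steps P"
  shows "P ! i \<le> P ! j"
  using partition_less[OF assms(1), of i j] assms by (cases "i = j") auto

lemma step_le_mesh: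
  assumes "n < steps P"
  shows "P ! Suc n - P ! n \<le> mesh P"
  unfolding mesh_def using assms by (intro Max_ge) auto

lemma mesh_pos:
  assumes "is_partition s t P" "s < t"
  shows "0 < steps P" "0 < mesh P"
proof -
  show *: "0 < steps P" using partition_nth(1,2)[OF assms(1)] assms(2) by (cases "steps P") auto
  show "0 < mesh P"
    using step_le_mesh[OF *] partition_less[OF assms(1), of 0 "Suc 0"] * by simp
qed

abbreviation driven_field :: "('m::finite \<Rightarrow> real^'e \<Rightarrow> real^'e) \<Rightarrow> real^'m \<Rightarrow> real^'e \<Rightarrow> real^'e" where
  "driven_field F z x \<equiv> \<Sum>a\<in>UNIV. z $ a *\<^sub>R F a x"

lemma driven_field_lipschitz:
  assumes "\<forall>a. Cb (Suc k) (F a)"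
  shows "\<exists>K>0. \<forall>x y. norm (driven_field F z x - driven_field F z y) \<le> K * norm (x - y)"
proof -
  have "\<forall>a. \<exists>L. \<forall>x y. norm (F a x - F a y) \<le> L * norm (x - y)"
    using Cb_Suc_lipschitz assms by metis
  then obtain L where L: "\<And>a x y. norm (F a x - F a y) \<le> L a * norm (x - y)" by metis
  let ?K = "\<Sum>a\<in>UNIV. \<bar>z $ a\<bar> * L a"
  have "norm (driven_field F z x - driven_field F z y) \<le> ?K * norm (x - y)" for x y
  proof -
    have "driven_field F z x - driven_field F z y = (\<Sum>a\<in>UNIV. z $ a *\<^sub>R (F a x - F a y))"
      by (simp add: sum_subtractf scaleR_diff_right)
    also have "norm \<dots> \<le> (\<Sum>a\<in>UNIV. \<bar>z $ a\<bar> * (L a * norm (x - y)))"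
      by (intro sum_norm_le) (simp add: L mult_left_mono)
    finally show ?thesis by (simp add: sum_distrib_right mult.assoc)
  qed
  moreover have "?K * norm (x - y) \<le> (\<bar>?K\<bar> + 1) * norm (x - y)" for x y :: "real^'e"
    by (intro mult_right_mono) auto
  ultimately have "norm (driven_field F z x - driven_field F z y) \<le> (\<bar>?K\<bar> + 1) * norm (x - y)" for x y
    by (rule order.trans)
  then show ?thesis by (intro exI[of _ "\<bar>?K\<bar> + 1"]) auto
qed

text \<open>The interpolated equation on the steps \<open>k, \<dots>, j - 1\<close>, indexed by partition points so that one can
induct on the last step.\<close>

definition solves_from ::
  "('m::finite \<Rightarrow> real^'e \<Rightarrow> real^'e) \<Rightarrow> (real \<Rightarrow> real^'m) \<Rightarrow> real list \<Rightarrow> nat \<Rightarrow> nat \<Rightarrow> (real \<Rightarrow> real^'e) \<Rightarrow> bool" where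
  "solves_from F Z P k j U \<longleftrightarrow> continuous_on {P ! k..P ! j} U \<and>
     (\<forall>n. k \<le> n \<and> n < j \<longrightarrow> (\<forall>t\<in>{P ! n<..<P ! Suc n}.
        (U has_vector_derivative
          driven_field F ((1 / (P ! Suc n - P ! n)) *\<^sub>R (Z (P ! Suc n) - Z (P ! n))) (U t)) (at t)))"

lemma interpolated_solution_iff:
  assumes P: "is_partition s t P" and k: "k \<le> steps P"
  shows "interpolated_solution F Z P (P ! k) U \<longleftrightarrow> solves_from F Z P k (steps P) U"
proof -
  have range: "k \<le> n \<longleftrightarrow> P ! k < r"
    if "r \<in> {P ! n<..<P ! Suc n}" "n < steps P" for n r
  proof (cases "k \<le> n")
    case True
    then show ?thesis using that partition_le[OF P True] by auto
  next
    case False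
    then show ?thesis using that partition_le[OF P, of "Suc n" k] k by auto
  qed
  have slope: "(\<Sum>a\<in>UNIV. ((Z (P ! Suc n) $ a - Z (P ! n) $ a) / (P ! Suc n - P ! n)) *\<^sub>R F a x)
      = driven_field F ((1 / (P ! Suc n - P ! n)) *\<^sub>R (Z (P ! Suc n) - Z (P ! n))) x" for n x
    by simp
  show ?thesis
    unfolding interpolated_solution_def solves_from_def partition_nth(3)[OF P] slope
  proof (intro conj_cong refl iffI allI impI ballI)
    fix n r
    assume ode: "\<forall>n<steps P. \<forall>t\<in>{P ! n<..<P ! Suc n}. P ! k < t \<longrightarrow> (U has_vector_derivative
        driven_field F ((1 / (P ! Suc n - P ! n)) *\<^sub>R (Z (P ! Suc n) - Z (P ! n))) (U t)) (at t)"
      and n: "k \<le> n \<and> n < steps P" and r: "r \<in> {P ! n<..<P ! Suc n}"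
    then show "(U has_vector_derivative
        driven_field F ((1 / (P ! Suc n - P ! n)) *\<^sub>R (Z (P ! Suc n) - Z (P ! n))) (U r)) (at r)"
      using range[OF r] by blast
  next
    fix n r
    assume ode: "\<forall>n. k \<le> n \<and> n < steps P \<longrightarrow> (\<forall>t\<in>{P ! n<..<P ! Suc n}. (U has_vector_derivative
        driven_field F ((1 / (P ! Suc n - P ! n)) *\<^sub>R (Z (P ! Suc n) - Z (P ! n))) (U t)) (at t))"
      and n: "n < steps P" and r: "r \<in> {P ! n<..<P ! Suc n}" "P ! k < r"
    then show "(U has_vector_derivative
        driven_field F ((1 / (P ! Suc n - P ! n)) *\<^sub>R (Z (P ! Suc n) - Z (P ! n))) (U r)) (at r)"
      using range[OF r(1) n] by blast
  qed
qed

lemma driven_step_exists: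
  assumes F: "\<forall>a. Cb (Suc k) (F a)" and st: "s < (t::real)"
  obtains V where "continuous_on {s..t} V" "V s = x"
    "\<And>r. r \<in> {s<..<t} \<Longrightarrow> (V has_vector_derivative driven_field F ((1 / (t - s)) *\<^sub>R z) (V r)) (at r)"
proof -
  obtain K where K: "0 < K" "\<And>x y. norm (driven_field F z x - driven_field F z y) \<le> K * norm (x - y)"
    using driven_field_lipschitz[OF F, of z] by blast
  obtain u where u: "continuous_on {0..1} u" "u 0 = x"
    "\<And>t. t \<in> {0<..<1} \<Longrightarrow> (u has_vector_derivative driven_field F z (u t)) (at t)"
    by (rule lipschitz_ode_exists[OF K, of x]) (rule that)
  let ?\<phi> = "\<lambda>r. (r - s) / (t - s)"
  show thesis
  proof (rule that[of "\<lambda>r. u (?\<phi> r)"])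
    show "continuous_on {s..t} (\<lambda>r. u (?\<phi> r))"
      by (rule continuous_on_compose2[OF u(1)]) (use st in \<open>auto intro!: continuous_intros simp: divide_simps\<close>)
    show "u (?\<phi> s) = x" using u(2) by simp
    fix r assume r: "r \<in> {s<..<t}"
    have "(?\<phi> has_real_derivative 1 / (t - s)) (at r)"
      using st by (auto intro!: derivative_eq_intros)
    moreover have "?\<phi> r \<in> {0<..<1}" using r st by (auto simp: divide_simps)
    ultimately have "(u \<circ> ?\<phi> has_vector_derivative (1 / (t - s)) *\<^sub>R driven_field F z (u (?\<phi> r))) (at r)"
      using u(3) by (intro vector_diff_chain_at) (auto simp: has_real_derivative_iff_has_vector_derivative)
    then show "((\<lambda>r. u (?\<phi> r)) has_vector_derivative driven_field F ((1 / (t - s)) *\<^sub>R z) (u (?\<phi> r))) (at r)"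
      by (simp add: o_def scaleR_sum_right)
  qed
qed

text \<open>On each further step the field is autonomous and globally Lipschitz; its solution is glued on.\<close>

lemma solves_from_exists:
  assumes P: "is_partition s t P" and F: "\<forall>a. Cb (Suc l) (F a)" and kj: "k \<le> j" "j \<le> steps P"
  shows "\<exists>U. solves_from F Z P k j U \<and> U (P ! k) = x"
  using kj
proof (induction j rule: dec_induct)
  case base
  show ?case by (rule exI[of _ "\<lambda>_. x"]) (simp add: solves_from_def)
next
  case (step j)
  let ?s = "P ! j" and ?t = "P ! Suc j" and ?z = "Z (P ! Suc j) - Z (P ! j)"
  have st: "P ! k \<le> ?s" "?s < ?t" using partition_le[OF P] partition_less[OF P] step by auto
  obtain U where U: "solves_from F Z P k j U" "U (P ! k) = x" using step by auto
  obtain V where V: "continuous_on {?s..?t} V" "V ?s = U ?s"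
    "\<And>r. r \<in> {?s<..<?t} \<Longrightarrow> (V has_vector_derivative driven_field F ((1 / (?t - ?s)) *\<^sub>R ?z) (V r)) (at r)"
    by (rule driven_step_exists[OF F st(2)]) (rule that)
  let ?W = "\<lambda>r. if r \<le> ?s then U r else V r"
  have "continuous_on ({P ! k..?s} \<union> {?s..?t}) ?W"
    by (rule continuous_on_If) (use U(1) V(1,2) st in \<open>auto simp: solves_from_def\<close>)
  moreover have "{P ! k..?s} \<union> {?s..?t} = {P ! k..?t}" using st by auto
  moreover have "(?W has_vector_derivative
      driven_field F ((1 / (P ! Suc n - P ! n)) *\<^sub>R (Z (P ! Suc n) - Z (P ! n))) (?W r)) (at r)"
    if n: "k \<le> n" "n < Suc j" and r: "r \<in> {P ! n<..<P ! Suc n}" for n r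
  proof (cases "n = j")
    case True
    have W: "?W r' = V r'" if "r' \<in> {?s<..<?t}" for r' using that by auto
    have r': "r \<in> {?s<..<?t}" using r True by simp
    show ?thesis
      unfolding True W[OF r']
      by (rule has_vector_derivative_transform_within_open[OF V(3)[OF r'] open_greaterThanLessThan r'])
         (use W in auto)
  next
    case False
    then have nj: "n < j" using n by simp
    then have "P ! Suc n \<le> ?s" using partition_le[OF P, of "Suc n" j] step by simp
    then have W: "?W r' = U r'" if "r' \<in> {P ! n<..<P ! Suc n}" for r' using that by auto
    have "(U has_vector_derivative
      driven_field F ((1 / (P ! Suc n - P ! n)) *\<^sub>R (Z (P ! Suc n) - Z (P ! n))) (U r)) (at r)"
      using U(1) n(1) nj r unfolding solves_from_def by blast
    then show ?thesis
      unfolding W[OF r]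
      by (rule has_vector_derivative_transform_within_open[OF _ open_greaterThanLessThan r]) (use W in auto)
  qed
  ultimately have "solves_from F Z P k (Suc j) ?W" by (simp add: solves_from_def)
  moreover have "?W (P ! k) = x" using U(2) st by simp
  ultimately show ?case by blast
qed

lemma solves_from_unique:
  assumes P: "is_partition s t P" and F: "\<forall>a. Cb (Suc l) (F a)" and kj: "k \<le> j" "j \<le> steps P"
    and "solves_from F Z P k j U" "solves_from F Z P k j V" "U (P ! k) = V (P ! k)" "r \<in> {P ! k..P ! j}"
  shows "U r = V r"
  using kj assms(5-)
proof (induction j arbitrary: r rule: dec_induct)
  case base
  then show ?case by simp
next
  case (step j)
  have st: "P ! k \<le> P ! j" "P ! j < P ! Suc j" using partition_le[OF P] partition_less[OF P] step by auto
  have restrict: "solves_from F Z P k j W" if "solves_from F Z P k (Suc j) W" for W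
    using that st unfolding solves_from_def by (auto elim: continuous_on_subset)
  have IH: "U r = V r" if "r \<in> {P ! k..P ! j}" for r
    using step.IH[OF _ restrict[OF step.prems(2)] restrict[OF step.prems(3)] step.prems(4) that]
      step.prems(1) by simp
  show ?case
  proof (cases "r \<le> P ! j")
    case True
    then show ?thesis using IH step.prems(5) by auto
  next
    case False
    let ?z = "(1 / (P ! Suc j - P ! j)) *\<^sub>R (Z (P ! Suc j) - Z (P ! j))"
    obtain K where K: "\<And>x y. norm (driven_field F ?z x - driven_field F ?z y) \<le> K * norm (x - y)"
      using driven_field_lipschitz[OF F, of ?z] by blast
    have ode: "(W has_vector_derivative driven_field F ?z (W r)) (at r)"
      if "solves_from F Z P k (Suc j) W" "P ! j < r" "r < P ! Suc j" for r W
    proof -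
      have "r \<in> {P ! j<..<P ! Suc j}" using that by simp
      then show ?thesis
        using that(1) step.hyps(1) unfolding solves_from_def by blast
    qed
    show ?thesis
    proof (rule lipschitz_ode_unique[OF K _ _ ode[OF step.prems(2)] ode[OF step.prems(3)]])
      show "continuous_on {P ! j..P ! Suc j} U" "continuous_on {P ! j..P ! Suc j} V"
        using step.prems(2,3) st by (auto simp: solves_from_def elim!: continuous_on_subset)
      show "U (P ! j) = V (P ! j)" using IH[of "P ! j"] st by simp
      show "r \<in> {P ! j..P ! Suc j}" using False step.prems(5) by auto
    qed
  qed
qed

context
  fixes F :: "'m::finite \<Rightarrow> real^'e \<Rightarrow> real^'e" and Z :: "real \<Rightarrow> real^'m" and l :: nat
    and s t :: real and P :: "real list"
  assumes P: "is_partition s t P" and F: "\<forall>a. Cb (Suc l) (F a)"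
begin

lemma interpolated_solution_exists:
  assumes "k \<le> steps P"
  shows "\<exists>U. interpolated_solution F Z P (P ! k) U \<and> U (P ! k) = x"
  unfolding interpolated_solution_iff[OF P assms] by (rule solves_from_exists[OF P F assms order_refl])

text \<open>Uniqueness makes the definite description in \<^const>\<open>flow\<close> meaningful.\<close>

lemma flow_eq:
  assumes k: "k \<le> steps P" and U: "interpolated_solution F Z P (P ! k) U" and r: "r \<in> {P ! k..P ! steps P}"
  shows "flow F Z P (P ! k) r (U (P ! k)) = U r"
  unfolding flow_def
proof (rule the_equality)
  fix z assume "\<exists>V. interpolated_solution F Z P (P ! k) V \<and> V (P ! k) = U (P ! k) \<and> V r = z"
  then obtain V where V: "interpolated_solution F Z P (P ! k) V" "V (P ! k) = U (P ! k)" "V r = z" by blast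
  have "V r = U r"
    using solves_from_unique[where U = V and V = U and r = r and Z = Z, OF P F k order_refl] V(1,2) U r
    by (simp add: interpolated_solution_iff[OF P k])
  with V(3) show "z = U r" by simp
qed (use U in blast)

lemma interpolated_solution_restrict:
  assumes "k \<le> k'" "k' \<le> steps P" "interpolated_solution F Z P (P ! k) U"
  shows "interpolated_solution F Z P (P ! k') U"
  using assms partition_le[OF P assms(1,2)] partition_le[OF P assms(2)]
  by (auto simp: interpolated_solution_iff[OF P] solves_from_def elim: continuous_on_subset)

lemma flow_compose:
  assumes "k \<le> k'" "k' \<le> n" "n \<le> steps P"
  shows "flow F Z P (P ! k') (P ! n) (flow F Z P (P ! k) (P ! k') x) = flow F Z P (P ! k) (P ! n) x"
proof -
  obtain U where U: "interpolated_solution F Z P (P ! k) U" "U (P ! k) = x"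
    using interpolated_solution_exists[of k x] assms by auto
  have ord: "P ! k \<le> P ! k'" "P ! k' \<le> P ! n" "P ! n \<le> P ! steps P"
    using partition_le[OF P] assms by auto
  have "flow F Z P (P ! k) r x = U r" if "r \<in> {P ! k..P ! steps P}" for r
    using flow_eq[of k U r] U assms that by simp
  moreover have "flow F Z P (P ! k') (P ! n) (U (P ! k')) = U (P ! n)"
    using assms ord interpolated_solution_restrict[OF _ _ U(1)] by (intro flow_eq) auto
  ultimately show ?thesis using ord by simp
qed

lemma flow_refl:
  assumes n: "n \<le> steps P"
  shows "flow F Z P (P ! n) (P ! n) x = x"
proof -
  obtain U where U: "interpolated_solution F Z P (P ! n) U" "U (P ! n) = x"
    using interpolated_solution_exists[OF n] by blast
  then show ?thesis
    using flow_eq[OF n U(1), of "P ! n"] partition_le[OF P n] by simp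
qed

text \<open>Lady Windermere's fan: follow the exact flow from the \<open>k\<close>-th numerical value to time \<open>t\<^sub>n\<close>. Consecutive
end points differ by the \<open>k\<close>-th local error, transported by the flow; the first end point is the exact
solution and the last one the numerical value.\<close>

lemma flow_error_telescope:
  assumes n: "n \<le> steps P"
    and lip: "\<And>k. k < n \<Longrightarrow> norm (flow F Z P (P ! Suc k) (P ! n) (flow F Z P (P ! k) (P ! Suc k) (v k))
        - flow F Z P (P ! Suc k) (P ! n) (v (Suc k))) \<le> L * norm (flow F Z P (P ! k) (P ! Suc k) (v k) - v (Suc k))"
  shows "norm (flow F Z P (P ! 0) (P ! n) (v 0) - v n)
      \<le> L * (\<Sum>k<n. norm (flow F Z P (P ! k) (P ! Suc k) (v k) - v (Suc k)))"
proof -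
  define a where "a k = flow F Z P (P ! k) (P ! n) (v k)" for k
  have "flow F Z P (P ! 0) (P ! n) (v 0) - v n = a 0 - a n"
    using flow_refl[OF n] by (simp add: a_def)
  also have "\<dots> = (\<Sum>k<n. a k - a (Suc k))" by (simp add: sum_lessThan_telescope')
  also have "norm \<dots> \<le> (\<Sum>k<n. L * norm (flow F Z P (P ! k) (P ! Suc k) (v k) - v (Suc k)))"
  proof (rule sum_norm_le)
    fix k assume "k \<in> {..<n}"
    then show "norm (a k - a (Suc k)) \<le> L * norm (flow F Z P (P ! k) (P ! Suc k) (v k) - v (Suc k))"
      using lip[of k] flow_compose[of k "Suc k" n "v k"] n by (simp add: a_def)
  qed
  finally show ?thesis by (simp add: sum_distrib_left)
qed

text \<open>Rescaling a step to length \<open>1\<close> turns the slope into the increment of the driver, and the length of the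
step disappears from the equation. This is why the local error is measured by the increment alone.\<close>

lemma flow_step_curve:
  assumes n: "n < steps P"
  obtains U where "continuous_on {0..1} U" "U 0 = x" "U 1 = flow F Z P (P ! n) (P ! Suc n) x"
    "\<And>r. r \<in> {0<..<1} \<Longrightarrow> (U has_vector_derivative driven_field F (Z (P ! Suc n) - Z (P ! n)) (U r)) (at r)"
proof -
  obtain V where V: "interpolated_solution F Z P (P ! n) V" "V (P ! n) = x"
    using interpolated_solution_exists[of n x] n by auto
  let ?h = "P ! Suc n - P ! n" and ?z = "Z (P ! Suc n) - Z (P ! n)"
  let ?\<phi> = "\<lambda>r. P ! n + r * ?h"
  have ord: "P ! n < P ! Suc n" "P ! Suc n \<le> P ! steps P"
    using partition_less[OF P] partition_le[OF P] n by auto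
  have sol: "solves_from F Z P n (steps P) V" using V(1) interpolated_solution_iff[OF P less_imp_le[OF n]] by blast
  have in_step: "?\<phi> r \<le> P ! Suc n" if "r \<le> 1" for r
  proof -
    have "?\<phi> r \<le> P ! n + 1 * ?h" using that ord by (intro add_left_mono mult_right_mono) auto
    also have "\<dots> = P ! Suc n" by simp
    finally show ?thesis .
  qed
  show thesis
  proof (rule that[of "\<lambda>r. V (?\<phi> r)"])
    show "continuous_on {0..1} (\<lambda>r. V (?\<phi> r))"
    proof (rule continuous_on_compose2[where g = V and f = ?\<phi>])
      show "continuous_on {P ! n..P ! steps P} V" using sol by (simp add: solves_from_def)
      show "?\<phi> ` {0..1} \<subseteq> {P ! n..P ! steps P}"
        using in_step ord by fastforce
    qed (intro continuous_intros)
    show "V (?\<phi> 0) = x" using V(2) by simp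
    show "V (?\<phi> 1) = flow F Z P (P ! n) (P ! Suc n) x"
      using flow_eq[of n V "P ! Suc n"] V n ord by simp
    fix r :: real assume r: "r \<in> {0<..<1}"
    have "P ! n < ?\<phi> r" using r ord by simp
    moreover have "?\<phi> r < P ! n + 1 * ?h"
      using r ord by (intro add_strict_left_mono mult_strict_right_mono) auto
    moreover have "P ! n + 1 * ?h = P ! Suc n" by simp
    ultimately have "?\<phi> r \<in> {P ! n<..<P ! Suc n}" by (simp only: greaterThanLessThan_iff)
    then have V': "(V has_vector_derivative driven_field F ((1 / ?h) *\<^sub>R ?z) (V (?\<phi> r))) (at (?\<phi> r))"
      using sol n by (simp add: solves_from_def)
    have "(?\<phi> has_vector_derivative ?h) (at r)"
      unfolding has_real_derivative_iff_has_vector_derivative[symmetric]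
      by (auto intro!: derivative_eq_intros)
    from vector_diff_chain_at[OF this V']
    have "((\<lambda>r. V (?\<phi> r)) has_vector_derivative ?h *\<^sub>R driven_field F ((1 / ?h) *\<^sub>R ?z) (V (?\<phi> r))) (at r)"
      by (simp add: o_def)
    moreover have "?h *\<^sub>R driven_field F ((1 / ?h) *\<^sub>R ?z) x = driven_field F ?z x" for x
      using ord by (simp add: scaleR_sum_right)
    ultimately show "((\<lambda>r. V (?\<phi> r)) has_vector_derivative driven_field F ?z (V (?\<phi> r))) (at r)"
      by simp
  qed
qed

end

section \<open>Convergence of the method\<close>

lemma scrk_flow_local_error:
  fixes A :: "real^'q^'q" and b :: "real^'q" and F :: "'m::finite \<Rightarrow> real^'e \<Rightarrow> real^'e"
  assumes p: "0 < p" and F: "\<forall>a. Cb p (F a)"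
    and tree_order: "\<And>\<tau> :: 'm rtree. vertices \<tau> \<le> p \<Longrightarrow> step_weight A b \<tau> = 1 / real (fact_rtree \<tau>)"
  shows "\<exists>C\<ge>0. \<forall>s t P n Z x S. is_partition s t P \<longrightarrow> n < steps P \<longrightarrow> norm (Z (P ! Suc n) - Z (P ! n)) \<le> M \<longrightarrow>
      scrk_stages A F Z (P ! n) (P ! Suc n) x (S (P ! n) (P ! Suc n) x) \<longrightarrow>
      norm (flow F Z P (P ! n) (P ! Suc n) x - scrk_step b F Z S (P ! n) (P ! Suc n) x)
        \<le> C * norm (Z (P ! Suc n) - Z (P ! n)) ^ Suc p"
proof -
  have Fp: "Cb p (F a)" for a using F by blast
  obtain C where C: "0 \<le> C" "\<forall>z U Y. norm z \<le> M \<longrightarrow> continuous_on {0..1} U \<longrightarrow>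
      (\<forall>t\<in>{0<..<1}. (U has_vector_derivative driven_field F z (U t)) (at t)) \<longrightarrow>
      (\<forall>i. Y i = U 0 + (\<Sum>a\<in>UNIV. \<Sum>j\<in>UNIV. (A $ i $ j * z $ a) *\<^sub>R F a (Y j))) \<longrightarrow>
      norm (U 1 - (U 0 + (\<Sum>a\<in>UNIV. \<Sum>i\<in>UNIV. (b $ i * z $ a) *\<^sub>R F a (Y i)))) \<le> C * norm z ^ Suc p"
    by (rule scrk_local_error[where F = F and A = A and b = b and p = p and M = M, OF Fp, THEN exE])
       (erule tree_order, elim conjE, rule that)
  have F': "\<forall>a. Cb (Suc (p - 1)) (F a)" using F p by simp
  show ?thesis
  proof (intro exI[of _ C] conjI allI impI)
    fix s t P n x and Z :: "real \<Rightarrow> real^'m" and S :: "real \<Rightarrow> real \<Rightarrow> real^'e \<Rightarrow> 'q \<Rightarrow> real^'e"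
    assume P: "is_partition s t P" and n: "n < steps P" and M: "norm (Z (P ! Suc n) - Z (P ! n)) \<le> M"
      and S: "scrk_stages A F Z (P ! n) (P ! Suc n) x (S (P ! n) (P ! Suc n) x)"
    obtain U where U: "continuous_on {0..1} U" "U 0 = x" "U 1 = flow F Z P (P ! n) (P ! Suc n) x"
      "\<And>r. r \<in> {0<..<1} \<Longrightarrow> (U has_vector_derivative driven_field F (Z (P ! Suc n) - Z (P ! n)) (U r)) (at r)"
      by (rule flow_step_curve[OF P F' n]) (rule that)
    have stages: "S (P ! n) (P ! Suc n) x i = U 0 + (\<Sum>a\<in>UNIV. \<Sum>j\<in>UNIV.
        (A $ i $ j * (Z (P ! Suc n) - Z (P ! n)) $ a) *\<^sub>R F a (S (P ! n) (P ! Suc n) x j))" for i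
      using S unfolding scrk_stages_def vector_minus_component U(2) by (rule spec)
    from C(2)[rule_format, OF M U(1,4) stages] show "norm (flow F Z P (P ! n) (P ! Suc n) x - scrk_step b F Z S (P ! n) (P ! Suc n) x)
        \<le> C * norm (Z (P ! Suc n) - Z (P ! n)) ^ Suc p"
      unfolding U(2,3) scrk_step_def vector_minus_component .
  qed (rule C(1))
qed

text \<open>Summing the local errors of all steps costs one power of the mesh.\<close>

lemma powr_step_sum_le:
  assumes P: "is_partition 0 T P" and \<beta>: "0 < \<beta>" and n: "n \<le> steps P"
  shows "(\<Sum>k<n. (P ! Suc k - P ! k) powr (1 + \<beta>)) \<le> T * mesh P powr \<beta>"
proof -
  have "(\<Sum>k<n. (P ! Suc k - P ! k) powr (1 + \<beta>)) \<le> (\<Sum>k<n. (P ! Suc k - P ! k) * mesh P powr \<beta>)"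
  proof (rule sum_mono)
    fix k assume "k \<in> {..<n}"
    then have k: "k < steps P" using n by simp
    then have h: "0 < P ! Suc k - P ! k" using partition_less[OF P, of k "Suc k"] by simp
    have "(P ! Suc k - P ! k) powr (1 + \<beta>) = (P ! Suc k - P ! k) * (P ! Suc k - P ! k) powr \<beta>"
      using h by (simp add: powr_add)
    also have "\<dots> \<le> (P ! Suc k - P ! k) * mesh P powr \<beta>"
      using h \<beta> step_le_mesh[OF k] by (intro mult_left_mono powr_mono2) auto
    finally show "(P ! Suc k - P ! k) powr (1 + \<beta>) \<le> (P ! Suc k - P ! k) * mesh P powr \<beta>" .
  qed
  also have "\<dots> = P ! n * mesh P powr \<beta>"
    using partition_nth(1)[OF P] by (simp add: sum_distrib_right[symmetric] sum_lessThan_telescope)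
  also have "\<dots> \<le> T * mesh P powr \<beta>"
    using partition_le[OF P n order_refl] partition_nth(2)[OF P] by (intro mult_right_mono) auto
  finally show ?thesis .
qed

lemma hoelder_on_bound:
  assumes "hoelder_on \<alpha> T Y"
  obtains C where "0 \<le> C" "\<And>s t. s \<in> {0..T} \<Longrightarrow> t \<in> {0..T} \<Longrightarrow> norm (Y t - Y s) \<le> C * \<bar>t - s\<bar> powr \<alpha>"
proof -
  obtain C where C: "\<And>s t. s \<in> {0..T} \<Longrightarrow> t \<in> {0..T} \<Longrightarrow> norm (Y t - Y s) \<le> C * \<bar>t - s\<bar> powr \<alpha>"
    using assms unfolding hoelder_on_def by blast
  have "norm (Y t - Y s) \<le> \<bar>C\<bar> * \<bar>t - s\<bar> powr \<alpha>" if "s \<in> {0..T}" "t \<in> {0..T}" for s t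
    by (rule order.trans[OF C[OF that]]) (simp add: mult_right_mono)
  then show thesis using that[of "\<bar>C\<bar>"] by simp
qed

text \<open>Once the mesh is below \<open>1\<close>, the smaller exponent dominates.\<close>

lemma bigo_mesh_min:
  fixes e :: "real list \<Rightarrow> real"
  assumes pos: "\<And>P. P \<in> \<P> \<Longrightarrow> 0 < mesh P" and e: "\<And>P. P \<in> \<P> \<Longrightarrow> 0 \<le> e P" and C: "0 < C"
    "\<And>P. P \<in> \<P> \<Longrightarrow> e P \<le> C * (mesh P powr r + mesh P powr \<beta>)"
  shows "e \<in> O[mesh_to_0 \<P>](\<lambda>P. mesh P powr min r \<beta>)"
proof (rule bigoI[of _ "2 * C"])
  have "\<forall>\<^sub>F P in filtercomap mesh (nhds 0). mesh P < 1"
  proof (rule eventually_filtercomapI)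
    show "\<forall>\<^sub>F h in nhds (0::real). h < 1" 
      using eventually_nhds_in_open[of "{..<1::real}" 0] by simp
  qed
  then have "\<forall>\<^sub>F P in mesh_to_0 \<P>. mesh P < 1 \<and> P \<in> \<P>"
    unfolding mesh_to_0_def by (auto simp: eventually_inf eventually_principal)
  then show "\<forall>\<^sub>F P in mesh_to_0 \<P>. norm (e P) \<le> 2 * C * norm (mesh P powr min r \<beta>)"
  proof (rule eventually_mono)
    fix P assume P: "mesh P < 1 \<and> P \<in> \<P>"
    have "mesh P powr r \<le> mesh P powr min r \<beta>" "mesh P powr \<beta> \<le> mesh P powr min r \<beta>"
      using P pos[of P] by (auto intro!: powr_mono')
    then have "mesh P powr r + mesh P powr \<beta> \<le> 2 * mesh P powr min r \<beta>" by simp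
    then have "C * (mesh P powr r + mesh P powr \<beta>) \<le> C * (2 * mesh P powr min r \<beta>)"
      using C(1) by (intro mult_left_mono) auto
    moreover have "norm (e P) = e P" using e[of P] P by simp
    ultimately have "norm (e P) \<le> C * (2 * mesh P powr min r \<beta>)" using C(2)[of P] P by linarith
    then show "norm (e P) \<le> 2 * C * norm (mesh P powr min r \<beta>)" by (simp add: mult_ac)
  qed
qed

theorem theorem6p6:
  fixes \<alpha> T C\<^sub>W\<^sub>Z r\<^sub>0 h\<^sub>0 R :: real
    and p :: nat
    and X :: "real \<Rightarrow> real^'d" and XX :: "real \<Rightarrow> real \<Rightarrow> real^'d^'d"
    and Z :: "real \<Rightarrow> real^'m" and Z' :: "real \<Rightarrow> (real^'d) \<Rightarrow>\<^sub>L (real^'m)"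
    and F :: "'m \<Rightarrow> real^'e \<Rightarrow> real^'e"
    and Y :: "real \<Rightarrow> real^'e" and Y' :: "real \<Rightarrow> (real^'d) \<Rightarrow>\<^sub>L (real^'e)"
    and A :: "real^'q^'q" and b :: "real^'q"
    and S :: "real \<Rightarrow> real \<Rightarrow> real^'e \<Rightarrow> 'q \<Rightarrow> real^'e"
    and y :: "real list \<Rightarrow> nat \<Rightarrow> real^'e"
    and \<P> :: "real list set" \<comment> \<open>the partitions considered\<close>
  assumes alpha: "1/3 < \<alpha>" "\<alpha> \<le> 1/2" and T: "0 < T"
    and p: "(real p + 1) * \<alpha> > 1"
    and X: "rough_path \<alpha> T X XX"
    and Z: "controlled \<alpha> T X Z Z'"
    and F: "\<And>a. Cb (p + 1) (F a)"
    and Y: "rde_solution \<alpha> T X XX Z Z' F Y Y'"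
    and partitions: "\<And>P. P \<in> \<P> \<Longrightarrow> is_partition 0 T P"
    and wong_zakai: "0 < C\<^sub>W\<^sub>Z" "0 < r\<^sub>0" "0 < h\<^sub>0"
      "\<And>P Y\<^sub>h t. is_partition 0 T P \<Longrightarrow> 0 < mesh P \<Longrightarrow> mesh P \<le> h\<^sub>0 \<Longrightarrow>
         interpolated_solution F Z P 0 Y\<^sub>h \<Longrightarrow> Y\<^sub>h 0 = Y 0 \<Longrightarrow> t \<in> {0..T} \<Longrightarrow>
         norm (Y t - Y\<^sub>h t) \<le> C\<^sub>W\<^sub>Z * mesh P powr r\<^sub>0"
    and stages: "\<And>P n. P \<in> \<P> \<Longrightarrow> n < steps P \<Longrightarrow>
         scrk_stages A F Z (P ! n) (P ! Suc n) (y P n) (S (P ! n) (P ! Suc n) (y P n))"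
    and tree_order: "\<And>\<tau> :: 'm rtree option. tree_size \<tau> \<le> p \<Longrightarrow>
         tree_weight A b \<tau> = 1 / real (tree_fact \<tau>)"
    and flow_lipschitz: "\<And>R'. 0 < R' \<Longrightarrow> \<exists>L>0. \<forall>P\<in>\<P>. \<forall>s t. 0 \<le> s \<and> s \<le> t \<and> t \<le> T \<longrightarrow>
         (\<forall>x\<in>cball 0 R'. \<forall>x'\<in>cball 0 R'.
            norm (flow F Z P s t x - flow F Z P s t x') \<le> L * norm (x - x'))"
    and scrk: "\<And>P. P \<in> \<P> \<Longrightarrow> y P 0 = Y 0"
      "\<And>P n. P \<in> \<P> \<Longrightarrow> n < steps P \<Longrightarrow>
         y P (Suc n) = scrk_step b F Z S (P ! n) (P ! Suc n) (y P n)"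
    and R: "0 < R"
      "\<And>P n. P \<in> \<P> \<Longrightarrow> n < steps P \<Longrightarrow>
         y P n \<in> cball 0 R \<and>
         flow F Z P (P ! n) (P ! Suc n) (y P n) \<in> cball 0 R \<and>
         scrk_step b F Z S (P ! n) (P ! Suc n) (y P n) \<in> cball 0 R"
  shows "(\<exists>C>0. \<forall>P\<in>\<P>. (MAX n\<in>{..steps P}. norm (Y (P ! n) - y P n))
            \<le> C * (mesh P powr r\<^sub>0 + mesh P powr ((real p + 1) * \<alpha> - 1))) \<and>
         (\<lambda>P. MAX n\<in>{..steps P}. norm (Y (P ! n) - y P n))
            \<in> O[mesh_to_0 \<P>](\<lambda>P. mesh P powr min r\<^sub>0 ((real p + 1) * \<alpha> - 1))"
proof -
  define \<beta> where "\<beta> = (real p + 1) * \<alpha> - 1"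
  have \<beta>: "0 < \<beta>" using p by (simp add: \<beta>_def)
  have p0: "0 < p" using p alpha by (cases p) auto
  have F1: "\<forall>a. Cb (Suc p) (F a)" using F unfolding Suc_eq_plus1 by blast
  have Fp: "\<forall>a. Cb p (F a)" by (intro allI Cb_mono[OF F]) simp
  obtain C\<^sub>Z where CZ: "0 \<le> C\<^sub>Z"
    "\<And>s t. s \<in> {0..T} \<Longrightarrow> t \<in> {0..T} \<Longrightarrow> norm (Z t - Z s) \<le> C\<^sub>Z * \<bar>t - s\<bar> powr \<alpha>"
  proof -
    have "hoelder_on \<alpha> T Z" using Z by (simp add: controlled_def)
    then show thesis by (rule hoelder_on_bound) (rule that)
  qed
  obtain C\<^sub>Y where CY: "0 \<le> C\<^sub>Y"
    "\<And>s t. s \<in> {0..T} \<Longrightarrow> t \<in> {0..T} \<Longrightarrow> norm (Y t - Y s) \<le> C\<^sub>Y * \<bar>t - s\<bar> powr \<alpha>"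
  proof -
    have "hoelder_on \<alpha> T Y" using Y by (simp add: rde_solution_def controlled_def)
    then show thesis by (rule hoelder_on_bound) (rule that)
  qed
  have order_cond: "step_weight A b \<tau> = 1 / real (fact_rtree \<tau>)" if "vertices \<tau> \<le> p" for \<tau> :: "'m rtree"
    using tree_order[of "Some \<tau>"] that by (simp add: tree_size_def tree_weight_def tree_fact_def)
  obtain C where C: "0 \<le> C" "\<And>s t P n Z x S. is_partition s t P \<Longrightarrow> n < steps P \<Longrightarrow>
      norm (Z (P ! Suc n) - Z (P ! n)) \<le> C\<^sub>Z * T powr \<alpha> \<Longrightarrow>
      scrk_stages A F Z (P ! n) (P ! Suc n) x (S (P ! n) (P ! Suc n) x) \<Longrightarrow>
      norm (flow F Z P (P ! n) (P ! Suc n) x - scrk_step b F Z S (P ! n) (P ! Suc n) x)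
        \<le> C * norm (Z (P ! Suc n) - Z (P ! n)) ^ Suc p"
    using scrk_flow_local_error[OF p0 Fp order_cond, of "C\<^sub>Z * T powr \<alpha>"] by blast
  obtain L where L: "0 < L" "\<And>P s t x x'. P \<in> \<P> \<Longrightarrow> 0 \<le> s \<Longrightarrow> s \<le> t \<Longrightarrow> t \<le> T \<Longrightarrow>
      x \<in> cball 0 R \<Longrightarrow> x' \<in> cball 0 R \<Longrightarrow> norm (flow F Z P s t x - flow F Z P s t x') \<le> L * norm (x - x')"
    using flow_lipschitz[OF R(1)] by blast
  \<comment> \<open>\<open>D\<close> is the constant of the global error of the scheme against the interpolated equation; \<open>E\<close> serves
      meshes above \<open>h\<^sub>0\<close>, where the Wong-Zakai bound says nothing but all quantities are bounded.\<close>
  define D where "D = L * (C * C\<^sub>Z ^ Suc p * T)"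
  define E where "E = (norm (Y 0) + C\<^sub>Y * T powr \<alpha> + R) / h\<^sub>0 powr r\<^sub>0"
  have D0: "0 \<le> D" using L C CZ T by (simp add: D_def)
  have E0: "0 \<le> E" using CY R by (simp add: E_def)
  have in_ball: "y P n \<in> cball 0 R" if P: "P \<in> \<P>" and n: "n \<le> steps P" for P n
  proof (cases "n < steps P")
    case False
    then obtain m where "n = Suc m" "m < steps P"
      using n mesh_pos(1)[OF partitions[OF P] T] by (cases n) auto
    then show ?thesis using R(2)[OF P] scrk(2)[OF P] by simp
  qed (use R(2)[OF P] in blast)
  have scheme: "norm (flow F Z P (P ! 0) (P ! n) (y P 0) - y P n) \<le> D * mesh P powr \<beta>"
    if P: "P \<in> \<P>" and n: "n \<le> steps P" for P n
  proof -
    note part = partitions[OF P]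
    \<comment> \<open>The increment is of size \<open>h\<^sup>\<alpha>\<close>, so a local error of order \<open>p + 1\<close> is of size \<open>h\<^sup>1\<^sup>+\<^sup>\<beta>\<close>.\<close>
    have local: "norm (flow F Z P (P ! k) (P ! Suc k) (y P k) - y P (Suc k))
        \<le> C * C\<^sub>Z ^ Suc p * (P ! Suc k - P ! k) powr (1 + \<beta>)" if k: "k < steps P" for k
    proof -
      let ?h = "P ! Suc k - P ! k"
      have ord: "0 \<le> P ! k" "P ! k < P ! Suc k" "P ! Suc k \<le> T"
        using partition_le[OF part, of 0 k] partition_less[OF part, of k "Suc k"]
          partition_le[OF part, of "Suc k" "steps P"] partition_nth[OF part] k by auto
      have incr: "norm (Z (P ! Suc k) - Z (P ! k)) \<le> C\<^sub>Z * ?h powr \<alpha>"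
        using CZ(2)[of "P ! k" "P ! Suc k"] ord by simp
      also have "\<dots> \<le> C\<^sub>Z * T powr \<alpha>"
        using ord alpha CZ(1) by (intro mult_left_mono powr_mono2) auto
      finally have M: "norm (Z (P ! Suc k) - Z (P ! k)) \<le> C\<^sub>Z * T powr \<alpha>" .
      have "norm (flow F Z P (P ! k) (P ! Suc k) (y P k) - y P (Suc k)) \<le> C * norm (Z (P ! Suc k) - Z (P ! k)) ^ Suc p"
        unfolding scrk(2)[OF P k] by (rule C(2)[where Z = Z and S = S and x = "y P k", OF part k M stages[OF P k]])
      also have "\<dots> \<le> C * (C\<^sub>Z * ?h powr \<alpha>) ^ Suc p"
        using incr C(1) by (intro mult_left_mono power_mono) auto
      also have "(?h powr \<alpha>) ^ Suc p = ?h powr (1 + \<beta>)"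
        using ord by (simp add: powr_realpow[symmetric] powr_powr \<beta>_def algebra_simps del: power_Suc)
      then have "C * (C\<^sub>Z * ?h powr \<alpha>) ^ Suc p = C * C\<^sub>Z ^ Suc p * ?h powr (1 + \<beta>)"
        by (simp only: power_mult_distrib mult.assoc)
      finally show ?thesis .
    qed
    have "norm (flow F Z P (P ! 0) (P ! n) (y P 0) - y P n)
        \<le> L * (\<Sum>k<n. norm (flow F Z P (P ! k) (P ! Suc k) (y P k) - y P (Suc k)))"
    proof (rule flow_error_telescope[OF part F1 n])
      fix k assume k: "k < n"
      then have "flow F Z P (P ! k) (P ! Suc k) (y P k) \<in> cball 0 R" "y P (Suc k) \<in> cball 0 R"
        using R(2)[OF P, of k] in_ball[OF P, of "Suc k"] n by auto
      moreover have "0 \<le> P ! Suc k" "P ! Suc k \<le> P ! n" "P ! n \<le> T"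
        using partition_le[OF part, of 0 "Suc k"] partition_le[OF part, of "Suc k" n]
          partition_le[OF part, of n "steps P"] partition_nth[OF part] k n by auto
      ultimately show "norm (flow F Z P (P ! Suc k) (P ! n) (flow F Z P (P ! k) (P ! Suc k) (y P k))
        - flow F Z P (P ! Suc k) (P ! n) (y P (Suc k))) \<le> L * norm (flow F Z P (P ! k) (P ! Suc k) (y P k) - y P (Suc k))"
        by (intro L(2)[OF P])
    qed
    also have "\<dots> \<le> L * (\<Sum>k<n. C * C\<^sub>Z ^ Suc p * (P ! Suc k - P ! k) powr (1 + \<beta>))"
      using L(1) local n by (intro mult_left_mono sum_mono) auto
    also have "\<dots> = L * (C * C\<^sub>Z ^ Suc p * (\<Sum>k<n. (P ! Suc k - P ! k) powr (1 + \<beta>)))"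
      by (simp only: sum_distrib_left)
    also have "\<dots> \<le> L * (C * C\<^sub>Z ^ Suc p * (T * mesh P powr \<beta>))"
      using L(1) C(1) CZ(1) by (intro mult_left_mono powr_step_sum_le[OF part \<beta> n]) auto
    finally show ?thesis by (simp only: D_def mult.assoc)
  qed
  define K where "K = C\<^sub>W\<^sub>Z + D + E"
  have K0: "0 < K" using wong_zakai(1) D0 E0 by (simp add: K_def)
  have error: "norm (Y (P ! n) - y P n) \<le> K * (mesh P powr r\<^sub>0 + mesh P powr \<beta>)"
    if P: "P \<in> \<P>" and n: "n \<le> steps P" for P n
  proof -
    note part = partitions[OF P]
    have time: "P ! n \<in> {0..T}"
      using partition_le[OF part, of 0 n] partition_le[OF part n order_refl] partition_nth[OF part] n by simp
    show ?thesis
    proof (cases "mesh P \<le> h\<^sub>0")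
      case True
      obtain U where U: "interpolated_solution F Z P (P ! 0) U" "U (P ! 0) = Y 0"
        using interpolated_solution_exists[OF part F1, of 0] by blast
      have "norm (Y (P ! n) - U (P ! n)) \<le> C\<^sub>W\<^sub>Z * mesh P powr r\<^sub>0"
        using wong_zakai(4)[OF part mesh_pos(2)[OF part T] True _ _ time] U partition_nth(1)[OF part] by simp
      moreover have "flow F Z P (P ! 0) (P ! n) (y P 0) = U (P ! n)"
        using flow_eq[OF part F1 _ U(1), of "P ! n"] U(2) scrk(1)[OF P] time partition_nth[OF part] by simp
      then have "norm (U (P ! n) - y P n) \<le> D * mesh P powr \<beta>"
        using scheme[OF P n] by simp
      moreover have "norm (Y (P ! n) - y P n) \<le> norm (Y (P ! n) - U (P ! n)) + norm (U (P ! n) - y P n)"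
        using norm_triangle_ineq[of "Y (P ! n) - U (P ! n)" "U (P ! n) - y P n"] by simp
      ultimately have "norm (Y (P ! n) - y P n) \<le> C\<^sub>W\<^sub>Z * mesh P powr r\<^sub>0 + D * mesh P powr \<beta>" by linarith
      also have "\<dots> \<le> K * mesh P powr r\<^sub>0 + K * mesh P powr \<beta>"
        using wong_zakai(1) D0 E0 by (intro add_mono mult_right_mono) (auto simp: K_def)
      finally show ?thesis by (simp only: distrib_left)
    next
      case False
      have "norm (Y (P ! n)) \<le> norm (Y 0) + norm (Y (P ! n) - Y 0)" by (rule norm_triangle_sub)
      also have "norm (Y (P ! n) - Y 0) \<le> C\<^sub>Y * \<bar>P ! n - 0\<bar> powr \<alpha>" using CY(2)[of 0 "P ! n"] time T by simp
      also have "\<dots> \<le> C\<^sub>Y * T powr \<alpha>" using time CY(1) alpha by (intro mult_left_mono powr_mono2) auto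
      finally have "norm (Y (P ! n) - y P n) \<le> norm (Y 0) + C\<^sub>Y * T powr \<alpha> + R"
        using norm_triangle_ineq4[of "Y (P ! n)" "y P n"] in_ball[OF P n] by simp
      also have "\<dots> = E * h\<^sub>0 powr r\<^sub>0" using wong_zakai(3) by (simp add: E_def)
      also have "\<dots> \<le> K * (mesh P powr r\<^sub>0 + mesh P powr \<beta>)"
      proof (rule mult_mono)
        have "h\<^sub>0 powr r\<^sub>0 \<le> mesh P powr r\<^sub>0" using False wong_zakai by (intro powr_mono2) auto
        then show "h\<^sub>0 powr r\<^sub>0 \<le> mesh P powr r\<^sub>0 + mesh P powr \<beta>"
          using powr_ge_zero[of "mesh P" \<beta>] by linarith
      qed (use wong_zakai(1) D0 K0 in \<open>auto simp: K_def\<close>)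
      finally show ?thesis .
    qed
  qed
  let ?e = "\<lambda>P. MAX n\<in>{..steps P}. norm (Y (P ! n) - y P n)"
  have bound: "?e P \<le> K * (mesh P powr r\<^sub>0 + mesh P powr \<beta>)" if "P \<in> \<P>" for P
    using error[OF that] by (intro Max.boundedI) auto
  have "0 \<le> ?e P" for P
    by (rule order.trans[OF norm_ge_zero[of "Y (P ! 0) - y P 0"]]) (intro Max_ge, auto)
  then have "?e \<in> O[mesh_to_0 \<P>](\<lambda>P. mesh P powr min r\<^sub>0 \<beta>)"
    using bound K0 mesh_pos(2)[OF partitions T] by (intro bigo_mesh_min[where C = K]) auto
  with bound K0 show ?thesis unfolding \<beta>_def by blast
qed

end
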